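(* The following hold in Bishop-style constructive mathematics. (i) If, for every set with apartness $S$ and every co-quasiorder $\tau$ on $S$, the class $a\tau$ is a d-subset of $S$ for every $a\in S$, then LPO holds. (ii) If, for every set with apartness $S$ and every co-quasiorder $\tau$ on $S$, the class $a\tau$ is an sd-subset of $S$ for every $a\in S$, then LPO holds.
   Context: All reasoning is constructive (Bishop style, intuitionistic logic, no law of excluded middle). A set with apartness $(S,=,\#)$ is an inhabited set $S$ with an equality $=$ (an equivalence relation) and a binary relation $\#$ (an apartness), extensional with respect to $=$, such that $\neg(x\# x)$; $x\# y\Rightarrow y\# x$; and $x\# z\Rightarrow\forall_y(x\# y\vee y\# z)$. Tightness is not assumed. Subsets are given by properties extensional with respect to $=$. For $Y\subseteq S$: $\neg Y=\{x\in S: x\notin Y\}$ and ${\sim}Y=\{x\in S:\forall_{y\in Y}(x\# y)\}$. $Y$ is a d-subset if $\forall_{x\in S}(x\in Y\vee x\in\neg Y)$, and an sd-subset if $\forall_{x\in S}(x\in Y\vee x\in{\sim}Y)$. A binary relation on $S$ is an inhabited subset of $S\times S$. A co-quasiorder on $S$ is a binary relation $\tau$ on $S$ that is strongly irreflexive ($(x,y)\in\tau\Rightarrow x\# y$) and co-transitive ($(x,y)\in\tau\Rightarrow\forall_{z\in S}((x,z)\in\tau\vee(z,y)\in\tau)$). For $a\in S$, $a\tau=\{x\in S:(a,x)\in\tau\}$. LPO: for each binary sequence $(a_n)_{n\ge1}$, either $a_n=0$ for all $n$, or else there exists $n$ with $a_n=1$. *)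

theory Defs
  imports Main
begin

text \<open>
  Isabelle/HOL is classical, so LPO stated about HOL functions is a theorem and an implication with
  conclusion LPO says nothing. ``Holds in Bishop-style constructive mathematics'' is therefore
  expressed as derivability in a formal system: Aczel's constructive set theory CZF, over
  intuitionistic first-order logic with equality.
\<close>

section \<open>Intuitionistic first-order logic\<close>

text \<open>
  The language has the relation symbols \<open>\<in>\<close> and \<open>=\<close> and no function symbols, so that the only terms
  are variables. These are de Bruijn indices.
\<close>

datatype fm =
    Mem nat nat
  | Eq nat nat
  | Bot
  | And fm fm
  | Or fm fm
  | Imp fm fm
  | Forall fm
  | Exists fm

definition lift_index :: "(nat \<Rightarrow> nat) \<Rightarrow> nat \<Rightarrow> nat" where
  "lift_index f = case_nat 0 (\<lambda>n. Suc (f n))"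

primrec rename :: "(nat \<Rightarrow> nat) \<Rightarrow> fm \<Rightarrow> fm" where
  "rename f (Mem i j) = Mem (f i) (f j)"
| "rename f (Eq i j) = Eq (f i) (f j)"
| "rename f Bot = Bot"
| "rename f (And p q) = And (rename f p) (rename f q)"
| "rename f (Or p q) = Or (rename f p) (rename f q)"
| "rename f (Imp p q) = Imp (rename f p) (rename f q)"
| "rename f (Forall p) = Forall (rename (lift_index f) p)"
| "rename f (Exists p) = Exists (rename (lift_index f) p)"

definition shift :: "fm \<Rightarrow> fm" where
  "shift = rename Suc"

text \<open>Replaces variable 0 by variable \<open>t\<close> and lowers all other indices, as on leaving a binder.\<close>

definition subst :: "fm \<Rightarrow> nat \<Rightarrow> fm" where
  "subst p t = rename (case_nat t (\<lambda>n. n)) p"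

text \<open>
  Natural deduction without excluded middle. The free variables of an axiom in \<open>T\<close> are read as
  universally quantified, which is why \<open>T\<close> is not shifted in \<open>AllI\<close> and \<open>ExE\<close>.
\<close>

inductive derives :: "fm set \<Rightarrow> fm list \<Rightarrow> fm \<Rightarrow> bool" for T :: "fm set" where
  Axiom: "p \<in> T \<Longrightarrow> derives T G p"
| Hyp: "p \<in> set G \<Longrightarrow> derives T G p"
| BotE: "derives T G Bot \<Longrightarrow> derives T G p"
| AndI: "derives T G p \<Longrightarrow> derives T G q \<Longrightarrow> derives T G (And p q)"
| AndE1: "derives T G (And p q) \<Longrightarrow> derives T G p"
| AndE2: "derives T G (And p q) \<Longrightarrow> derives T G q"
| OrI1: "derives T G p \<Longrightarrow> derives T G (Or p q)"
| OrI2: "derives T G q \<Longrightarrow> derives T G (Or p q)"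
| OrE: "derives T G (Or p q) \<Longrightarrow> derives T (p # G) r \<Longrightarrow> derives T (q # G) r \<Longrightarrow> derives T G r"
| ImpI: "derives T (p # G) q \<Longrightarrow> derives T G (Imp p q)"
| ImpE: "derives T G (Imp p q) \<Longrightarrow> derives T G p \<Longrightarrow> derives T G q"
| AllI: "derives T (map shift G) p \<Longrightarrow> derives T G (Forall p)"
| AllE: "derives T G (Forall p) \<Longrightarrow> derives T G (subst p t)"
| ExI: "derives T G (subst p t) \<Longrightarrow> derives T G (Exists p)"
| ExE: "derives T G (Exists p) \<Longrightarrow> derives T (p # map shift G) (shift q) \<Longrightarrow> derives T G q"
| EqI: "derives T G (Eq s s)"
| EqE: "derives T G (Eq s t) \<Longrightarrow> derives T G (subst p s) \<Longrightarrow> derives T G (subst p t)"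


section \<open>Writing formulas with named bound variables\<close>

text \<open>
  A \<open>form\<close> is a formula waiting for the number \<open>d\<close> of binders it stands under. A bound variable is
  passed around as its binding level \<open>x < d\<close> (outermost binder: level 0), whose de Bruijn index
  at depth \<open>d\<close> is \<open>d - Suc x\<close>. A closed sentence is obtained at depth 0.
\<close>

type_synonym form = "nat \<Rightarrow> fm"
type_synonym cls = "nat \<Rightarrow> form"

definition memF :: "nat \<Rightarrow> nat \<Rightarrow> form" (infix "\<^bold>\<in>" 50) where
  "(x \<^bold>\<in> y) = (\<lambda>d. Mem (d - Suc x) (d - Suc y))"

definition eqF :: "nat \<Rightarrow> nat \<Rightarrow> form" (infix "\<^bold>=" 50) where
  "(x \<^bold>= y) = (\<lambda>d. Eq (d - Suc x) (d - Suc y))"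

definition andF :: "form \<Rightarrow> form \<Rightarrow> form" (infixr "\<^bold>\<and>" 35) where
  "(p \<^bold>\<and> q) = (\<lambda>d. And (p d) (q d))"

definition orF :: "form \<Rightarrow> form \<Rightarrow> form" (infixr "\<^bold>\<or>" 30) where
  "(p \<^bold>\<or> q) = (\<lambda>d. Or (p d) (q d))"

definition impF :: "form \<Rightarrow> form \<Rightarrow> form" (infixr "\<^bold>\<longrightarrow>" 25) where
  "(p \<^bold>\<longrightarrow> q) = (\<lambda>d. Imp (p d) (q d))"

definition iffF :: "form \<Rightarrow> form \<Rightarrow> form" (infixr "\<^bold>\<longleftrightarrow>" 25) where
  "(p \<^bold>\<longleftrightarrow> q) = ((p \<^bold>\<longrightarrow> q) \<^bold>\<and> (q \<^bold>\<longrightarrow> p))"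

definition falseF :: form ("\<^bold>\<bottom>") where
  "\<^bold>\<bottom> = (\<lambda>d. Bot)"

definition notF :: "form \<Rightarrow> form" ("\<^bold>\<not> _" [40] 40) where
  "(\<^bold>\<not> p) = (p \<^bold>\<longrightarrow> \<^bold>\<bottom>)"

definition allF :: "cls \<Rightarrow> form" (binder "\<^bold>\<forall>" 10) where
  "(\<^bold>\<forall>x. P x) = (\<lambda>d. Forall (P d (Suc d)))"

definition exF :: "cls \<Rightarrow> form" (binder "\<^bold>\<exists>" 10) where
  "(\<^bold>\<exists>x. P x) = (\<lambda>d. Exists (P d (Suc d)))"

definition ballF :: "nat \<Rightarrow> cls \<Rightarrow> form" where
  "ballF a P = (\<^bold>\<forall>x. x \<^bold>\<in> a \<^bold>\<longrightarrow> P x)"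

definition bexF :: "nat \<Rightarrow> cls \<Rightarrow> form" where
  "bexF a P = (\<^bold>\<exists>x. x \<^bold>\<in> a \<^bold>\<and> P x)"

syntax
  "_ballF" :: "pttrn \<Rightarrow> nat \<Rightarrow> form \<Rightarrow> form" ("(3\<^bold>\<forall>_\<^bold>\<in>_./ _)" [0, 0, 10] 10)
  "_bexF" :: "pttrn \<Rightarrow> nat \<Rightarrow> form \<Rightarrow> form" ("(3\<^bold>\<exists>_\<^bold>\<in>_./ _)" [0, 0, 10] 10)
translations
  "\<^bold>\<forall>x\<^bold>\<in>a. p" \<rightleftharpoons> "CONST ballF a (\<lambda>x. p)"
  "\<^bold>\<exists>x\<^bold>\<in>a. p" \<rightleftharpoons> "CONST bexF a (\<lambda>x. p)"

text \<open>
  For axiom schemes: variable \<open>i < length xs\<close> of \<open>p\<close> is replaced by the bound variable \<open>xs ! i\<close>; the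
  variables of \<open>p\<close> from \<open>length xs\<close> on are parameters and stay free below all \<open>d\<close> binders.
\<close>

definition inst :: "fm \<Rightarrow> nat list \<Rightarrow> form" where
  "inst p xs = (\<lambda>d. rename
     (\<lambda>i. if i < length xs then d - Suc (xs ! i) else i - length xs + d) p)"


section \<open>The set theory CZF\<close>

definition emptyF :: cls where
  "emptyF u = (\<^bold>\<forall>v\<^bold>\<in>u. \<^bold>\<bottom>)"

text \<open>\<open>u = x \<union> {x}\<close>\<close>

definition succF :: "nat \<Rightarrow> nat \<Rightarrow> form" where
  "succF x u = (x \<^bold>\<in> u \<^bold>\<and> (\<^bold>\<forall>v\<^bold>\<in>x. v \<^bold>\<in> u) \<^bold>\<and> (\<^bold>\<forall>v\<^bold>\<in>u. v \<^bold>\<in> x \<^bold>\<or> v \<^bold>= x))"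

definition inductiveF :: cls where
  "inductiveF w = ((\<^bold>\<exists>u\<^bold>\<in>w. emptyF u) \<^bold>\<and> (\<^bold>\<forall>x\<^bold>\<in>w. \<^bold>\<exists>u\<^bold>\<in>w. succF x u))"

definition omegaF :: cls where
  "omegaF w = (inductiveF w \<^bold>\<and> (\<^bold>\<forall>z. inductiveF z \<^bold>\<longrightarrow> (\<^bold>\<forall>x\<^bold>\<in>w. x \<^bold>\<in> z)))"

inductive bounded_fm :: "fm \<Rightarrow> bool" where
  "bounded_fm (Mem i j)"
| "bounded_fm (Eq i j)"
| "bounded_fm Bot"
| "bounded_fm p \<Longrightarrow> bounded_fm q \<Longrightarrow> bounded_fm (And p q)"
| "bounded_fm p \<Longrightarrow> bounded_fm q \<Longrightarrow> bounded_fm (Or p q)"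
| "bounded_fm p \<Longrightarrow> bounded_fm q \<Longrightarrow> bounded_fm (Imp p q)"
| "bounded_fm p \<Longrightarrow> bounded_fm (Forall (Imp (Mem 0 (Suc j)) p))"
| "bounded_fm p \<Longrightarrow> bounded_fm (Exists (And (Mem 0 (Suc j)) p))"

definition extensionality :: form where
  "extensionality = (\<^bold>\<forall>a b. (\<^bold>\<forall>x. x \<^bold>\<in> a \<^bold>\<longleftrightarrow> x \<^bold>\<in> b) \<^bold>\<longrightarrow> a \<^bold>= b)"

definition pairing :: form where
  "pairing = (\<^bold>\<forall>a b. \<^bold>\<exists>c. \<^bold>\<forall>x. x \<^bold>\<in> c \<^bold>\<longleftrightarrow> x \<^bold>= a \<^bold>\<or> x \<^bold>= b)"

definition union_axiom :: form where
  "union_axiom = (\<^bold>\<forall>a. \<^bold>\<exists>c. \<^bold>\<forall>x. x \<^bold>\<in> c \<^bold>\<longleftrightarrow> (\<^bold>\<exists>y\<^bold>\<in>a. x \<^bold>\<in> y))"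

definition strong_infinity :: form where
  "strong_infinity = (\<^bold>\<exists>w. omegaF w)"

definition set_induction :: "fm \<Rightarrow> form" where
  "set_induction p =
    ((\<^bold>\<forall>a. (\<^bold>\<forall>x\<^bold>\<in>a. inst p [x]) \<^bold>\<longrightarrow> inst p [a]) \<^bold>\<longrightarrow> (\<^bold>\<forall>a. inst p [a]))"

definition separation :: "fm \<Rightarrow> form" where
  "separation p = (\<^bold>\<forall>a. \<^bold>\<exists>c. \<^bold>\<forall>x. x \<^bold>\<in> c \<^bold>\<longleftrightarrow> x \<^bold>\<in> a \<^bold>\<and> inst p [x])"

definition strong_collection :: "fm \<Rightarrow> form" where
  "strong_collection p =
    (\<^bold>\<forall>a. (\<^bold>\<forall>x\<^bold>\<in>a. \<^bold>\<exists>y. inst p [x, y]) \<^bold>\<longrightarrow>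
      (\<^bold>\<exists>c. (\<^bold>\<forall>x\<^bold>\<in>a. \<^bold>\<exists>y\<^bold>\<in>c. inst p [x, y]) \<^bold>\<and> (\<^bold>\<forall>y\<^bold>\<in>c. \<^bold>\<exists>x\<^bold>\<in>a. inst p [x, y])))"

definition subset_collection :: "fm \<Rightarrow> form" where
  "subset_collection p =
    (\<^bold>\<forall>a b. \<^bold>\<exists>c. \<^bold>\<forall>u. (\<^bold>\<forall>x\<^bold>\<in>a. \<^bold>\<exists>y\<^bold>\<in>b. inst p [x, y, u]) \<^bold>\<longrightarrow>
      (\<^bold>\<exists>e\<^bold>\<in>c. (\<^bold>\<forall>x\<^bold>\<in>a. \<^bold>\<exists>y\<^bold>\<in>e. inst p [x, y, u]) \<^bold>\<and> (\<^bold>\<forall>y\<^bold>\<in>e. \<^bold>\<exists>x\<^bold>\<in>a. inst p [x, y, u])))"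

definition CZF :: "fm set" where
  "CZF =
     {extensionality 0, pairing 0, union_axiom 0, strong_infinity 0}
     \<union> range (\<lambda>p. set_induction p 0)
     \<union> {separation p 0 |p. bounded_fm p}
     \<union> range (\<lambda>p. strong_collection p 0)
     \<union> range (\<lambda>p. subset_collection p 0)"

definition proves :: "fm set \<Rightarrow> form \<Rightarrow> bool" (infix "\<turnstile>" 20) where
  "(T \<turnstile> p) \<longleftrightarrow> derives T [] (p 0)"


section \<open>Sets with apartness\<close>

text \<open>\<open>u = {x, y}\<close>\<close>

definition upairF :: "nat \<Rightarrow> nat \<Rightarrow> nat \<Rightarrow> form" where
  "upairF u x y = (x \<^bold>\<in> u \<^bold>\<and> y \<^bold>\<in> u \<^bold>\<and> (\<^bold>\<forall>v\<^bold>\<in>u. v \<^bold>= x \<^bold>\<or> v \<^bold>= y))"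

text \<open>\<open>p = (x, y) = {{x}, {x, y}}\<close>\<close>

definition opairF :: "nat \<Rightarrow> nat \<Rightarrow> nat \<Rightarrow> form" where
  "opairF p x y =
    ((\<^bold>\<exists>u\<^bold>\<in>p. upairF u x x) \<^bold>\<and> (\<^bold>\<exists>u\<^bold>\<in>p. upairF u x y) \<^bold>\<and>
     (\<^bold>\<forall>u\<^bold>\<in>p. upairF u x x \<^bold>\<or> upairF u x y))"

text \<open>\<open>(x, y) \<in> r\<close>\<close>

definition relF :: "nat \<Rightarrow> nat \<Rightarrow> nat \<Rightarrow> form" where
  "relF r x y = (\<^bold>\<exists>p\<^bold>\<in>r. opairF p x y)"

text \<open>\<open>r \<subseteq> S \<times> S\<close>\<close>

definition subset_prodF :: "nat \<Rightarrow> nat \<Rightarrow> form" where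
  "subset_prodF r S = (\<^bold>\<forall>p\<^bold>\<in>r. \<^bold>\<exists>x\<^bold>\<in>S. \<^bold>\<exists>y\<^bold>\<in>S. opairF p x y)"

definition extensionalF :: "nat \<Rightarrow> nat \<Rightarrow> nat \<Rightarrow> form" where
  "extensionalF S eq r =
    (\<^bold>\<forall>x\<^bold>\<in>S. \<^bold>\<forall>x'\<^bold>\<in>S. \<^bold>\<forall>y\<^bold>\<in>S. \<^bold>\<forall>y'\<^bold>\<in>S.
      relF eq x x' \<^bold>\<and> relF eq y y' \<^bold>\<and> relF r x y \<^bold>\<longrightarrow> relF r x' y')"

definition equivalenceF :: "nat \<Rightarrow> nat \<Rightarrow> form" where
  "equivalenceF S eq =
    (subset_prodF eq S \<^bold>\<and>
     (\<^bold>\<forall>x\<^bold>\<in>S. relF eq x x) \<^bold>\<and>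
     (\<^bold>\<forall>x\<^bold>\<in>S. \<^bold>\<forall>y\<^bold>\<in>S. relF eq x y \<^bold>\<longrightarrow> relF eq y x) \<^bold>\<and>
     (\<^bold>\<forall>x\<^bold>\<in>S. \<^bold>\<forall>y\<^bold>\<in>S. \<^bold>\<forall>z\<^bold>\<in>S. relF eq x y \<^bold>\<and> relF eq y z \<^bold>\<longrightarrow> relF eq x z))"

definition apartnessF :: "nat \<Rightarrow> nat \<Rightarrow> nat \<Rightarrow> form" where
  "apartnessF S eq ap =
    (subset_prodF ap S \<^bold>\<and> extensionalF S eq ap \<^bold>\<and>
     (\<^bold>\<forall>x\<^bold>\<in>S. \<^bold>\<not> relF ap x x) \<^bold>\<and>
     (\<^bold>\<forall>x\<^bold>\<in>S. \<^bold>\<forall>y\<^bold>\<in>S. relF ap x y \<^bold>\<longrightarrow> relF ap y x) \<^bold>\<and>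
     (\<^bold>\<forall>x\<^bold>\<in>S. \<^bold>\<forall>z\<^bold>\<in>S. relF ap x z \<^bold>\<longrightarrow> (\<^bold>\<forall>y\<^bold>\<in>S. relF ap x y \<^bold>\<or> relF ap y z)))"

text \<open>
  The equality of \<open>S\<close> is an arbitrary equivalence relation \<open>eq\<close>. The apartness is not required to be
  inhabited, unlike the relations of \<open>binary_relation\<close>.
\<close>

definition set_with_apartness :: "nat \<Rightarrow> nat \<Rightarrow> nat \<Rightarrow> form" where
  "set_with_apartness S eq ap =
    ((\<^bold>\<exists>x. x \<^bold>\<in> S) \<^bold>\<and> equivalenceF S eq \<^bold>\<and> apartnessF S eq ap)"

definition binary_relation :: "nat \<Rightarrow> nat \<Rightarrow> nat \<Rightarrow> form" where
  "binary_relation S eq r = ((\<^bold>\<exists>p. p \<^bold>\<in> r) \<^bold>\<and> subset_prodF r S \<^bold>\<and> extensionalF S eq r)"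

definition co_quasiorder :: "nat \<Rightarrow> nat \<Rightarrow> nat \<Rightarrow> nat \<Rightarrow> form" where
  "co_quasiorder S eq ap \<tau> =
    (binary_relation S eq \<tau> \<^bold>\<and>
     (\<^bold>\<forall>x\<^bold>\<in>S. \<^bold>\<forall>y\<^bold>\<in>S. relF \<tau> x y \<^bold>\<longrightarrow> relF ap x y) \<^bold>\<and>
     (\<^bold>\<forall>x\<^bold>\<in>S. \<^bold>\<forall>y\<^bold>\<in>S. relF \<tau> x y \<^bold>\<longrightarrow> (\<^bold>\<forall>z\<^bold>\<in>S. relF \<tau> x z \<^bold>\<or> relF \<tau> z y)))"

text \<open>\<open>a\<tau>\<close>\<close>

definition right_class :: "nat \<Rightarrow> nat \<Rightarrow> nat \<Rightarrow> cls" where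
  "right_class S \<tau> a = (\<lambda>x. x \<^bold>\<in> S \<^bold>\<and> relF \<tau> a x)"

text \<open>\<open>\<not>Y\<close> and \<open>\<sim>Y\<close>\<close>

definition logical_complement :: "nat \<Rightarrow> cls \<Rightarrow> cls" where
  "logical_complement S Y = (\<lambda>x. x \<^bold>\<in> S \<^bold>\<and> \<^bold>\<not> Y x)"

definition apartness_complement :: "nat \<Rightarrow> nat \<Rightarrow> cls \<Rightarrow> cls" where
  "apartness_complement S ap Y = (\<lambda>x. x \<^bold>\<in> S \<^bold>\<and> (\<^bold>\<forall>y. Y y \<^bold>\<longrightarrow> relF ap x y))"

definition d_subset :: "nat \<Rightarrow> cls \<Rightarrow> form" where
  "d_subset S Y = (\<^bold>\<forall>x\<^bold>\<in>S. Y x \<^bold>\<or> logical_complement S Y x)"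

definition sd_subset :: "nat \<Rightarrow> nat \<Rightarrow> cls \<Rightarrow> form" where
  "sd_subset S ap Y = (\<^bold>\<forall>x\<^bold>\<in>S. Y x \<^bold>\<or> apartness_complement S ap Y x)"


section \<open>The limited principle of omniscience\<close>

text \<open>\<open>u = 1 = {0}\<close>\<close>

definition oneF :: cls where
  "oneF u = ((\<^bold>\<exists>z\<^bold>\<in>u. emptyF z) \<^bold>\<and> (\<^bold>\<forall>z\<^bold>\<in>u. emptyF z))"

text \<open>Given \<open>w = \<omega>\<close>: \<open>n\<close> is an index \<open>n \<ge> 1\<close>.\<close>

definition index :: "nat \<Rightarrow> cls" where
  "index w n = (n \<^bold>\<in> w \<^bold>\<and> \<^bold>\<not> emptyF n)"

text \<open>Given \<open>w = \<omega>\<close>: \<open>a\<close> is (the graph of) a function from \<open>{n. n \<ge> 1}\<close> to \<open>{0, 1}\<close>.\<close>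

definition binary_sequence :: "nat \<Rightarrow> cls" where
  "binary_sequence w a =
    ((\<^bold>\<forall>p\<^bold>\<in>a. \<^bold>\<exists>n v. index w n \<^bold>\<and> (emptyF v \<^bold>\<or> oneF v) \<^bold>\<and> opairF p n v) \<^bold>\<and>
     (\<^bold>\<forall>n. index w n \<^bold>\<longrightarrow> (\<^bold>\<exists>v. relF a n v \<^bold>\<and> (\<^bold>\<forall>v'. relF a n v' \<^bold>\<longrightarrow> v' \<^bold>= v))))"

definition LPO :: form where
  "LPO =
    (\<^bold>\<forall>w a. omegaF w \<^bold>\<and> binary_sequence w a \<^bold>\<longrightarrow>
      (\<^bold>\<forall>n. index w n \<^bold>\<longrightarrow> (\<^bold>\<exists>v. emptyF v \<^bold>\<and> relF a n v)) \<^bold>\<or>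
      (\<^bold>\<exists>n. index w n \<^bold>\<and> (\<^bold>\<exists>v. oneF v \<^bold>\<and> relF a n v)))"

end

theory Submission
  imports Defs
begin

text \<open>
  Given a formula \<open>\<phi>\<close>, take \<open>S = {0, 1}\<close> with its discrete equality and apartness, and let \<open>\<tau>\<close>
  consist of \<open>(1, 0)\<close> and, provided that \<open>\<phi>\<close> holds, \<open>(0, 1)\<close>. With only two points, co-transitivity
  is automatic, so \<open>\<tau>\<close> is a co-quasiorder, and deciding whether \<open>1\<close> lies in \<open>0\<tau>\<close> decides \<open>\<phi>\<close>. For
  \<open>\<phi>\<close> the assertion that a binary sequence takes the value 1, written as a bounded formula so that
  separation yields \<open>\<tau>\<close>, this is LPO. If \<open>0\<tau>\<close> is an sd-subset, the alternative that \<open>1\<close> is apart from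
  all of \<open>0\<tau>\<close> also refutes \<open>\<phi>\<close>, as \<open>1\<close> is not apart from itself.

  Derivations are built with lists of hypotheses as the worlds of a Kripke-style semantics: a fact
  derived from \<open>G\<close> persists to every larger \<open>G'\<close>, and implications are proved at all larger \<open>G'\<close>.
\<close>

section \<open>Renaming\<close>

lemma lift_index_simps [simp]:
  "lift_index f 0 = 0" "lift_index f (Suc n) = Suc (f n)"
  by (simp_all add: lift_index_def)

lemma lift_index_comp: "lift_index f \<circ> lift_index g = lift_index (f \<circ> g)"
  by (auto simp: lift_index_def fun_eq_iff split: nat.split)

lemma rename_rename: "rename f (rename g p) = rename (f \<circ> g) p"
  by (induction p arbitrary: f g) (simp_all add: lift_index_comp)

lemma rename_lift_shift: "rename (lift_index f) (shift p) = shift (rename f p)"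
proof -
  have "lift_index f \<circ> Suc = Suc \<circ> f" by (auto simp: fun_eq_iff)
  then show ?thesis by (simp add: shift_def rename_rename)
qed

text \<open>As the only terms are variables, substitution is itself a renaming, and the claim
  reduces to an equation between two maps on indices.\<close>

lemma rename_subst: "rename f (subst p t) = subst (rename (lift_index f) p) (f t)"
proof -
  have "f \<circ> case_nat t (\<lambda>n. n) = case_nat (f t) (\<lambda>n. n) \<circ> lift_index f"
    by (auto simp: fun_eq_iff split: nat.split)
  then show ?thesis by (simp add: subst_def rename_rename)
qed

text \<open>Only finitely many indices occur in a formula, and \<open>n\<close> bounds the free
  ones. Below a binder the bound for the body still suffices: \<open>lift_index f\<close> fixes 0,
  and at \<open>Suc i\<close> it depends only on \<open>f i\<close>. Fresh variables are chosen
  beyond such a bound.\<close>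

lemma rename_cong_below:
  "\<exists>n. \<forall>f g. (\<forall>i<n. f i = g i) \<longrightarrow> rename f p = rename g p"
proof (induction p)
  case (Mem i j)
  show ?case by (rule exI[of _ "Suc (max i j)"]) (simp add: less_Suc_eq_le)
next
  case (Eq i j)
  show ?case by (rule exI[of _ "Suc (max i j)"]) (simp add: less_Suc_eq_le)
next
  case Bot
  show ?case by simp
next
  case (And p q)
  then obtain m n where
    "\<forall>f g. (\<forall>i<m. f i = g i) \<longrightarrow> rename f p = rename g p"
    "\<forall>f g. (\<forall>i<n. f i = g i) \<longrightarrow> rename f q = rename g q" by blast
  then show ?case by (intro exI[of _ "max m n"]) (auto simp: less_max_iff_disj)
next
  case (Or p q)
  then obtain m n where
    "\<forall>f g. (\<forall>i<m. f i = g i) \<longrightarrow> rename f p = rename g p"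
    "\<forall>f g. (\<forall>i<n. f i = g i) \<longrightarrow> rename f q = rename g q" by blast
  then show ?case by (intro exI[of _ "max m n"]) (auto simp: less_max_iff_disj)
next
  case (Imp p q)
  then obtain m n where
    "\<forall>f g. (\<forall>i<m. f i = g i) \<longrightarrow> rename f p = rename g p"
    "\<forall>f g. (\<forall>i<n. f i = g i) \<longrightarrow> rename f q = rename g q" by blast
  then show ?case by (intro exI[of _ "max m n"]) (auto simp: less_max_iff_disj)
next
  case (Forall p)
  then obtain n where "\<forall>f g. (\<forall>i<n. f i = g i) \<longrightarrow> rename f p = rename g p" by blast
  then show ?case
    by (intro exI[of _ n]) (auto simp: lift_index_def split: nat.split)
next
  case (Exists p)
  then obtain n where "\<forall>f g. (\<forall>i<n. f i = g i) \<longrightarrow> rename f p = rename g p" by blast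
  then show ?case
    by (intro exI[of _ n]) (auto simp: lift_index_def split: nat.split)
qed

lemma rename_cong_below_list:
  "\<exists>n. \<forall>f g. (\<forall>i<n. f i = g i) \<longrightarrow> (\<forall>p\<in>set G. rename f p = rename g p)"
proof (induction G)
  case (Cons p G)
  moreover obtain m where "\<forall>f g. (\<forall>i<m. f i = g i) \<longrightarrow> rename f p = rename g p"
    using rename_cong_below by blast
  ultimately obtain n where
    "\<forall>f g. (\<forall>i<m. f i = g i) \<longrightarrow> rename f p = rename g p"
    "\<forall>f g. (\<forall>i<n. f i = g i) \<longrightarrow> (\<forall>p\<in>set G. rename f p = rename g p)" by blast
  then show ?case by (intro exI[of _ "max m n"]) (auto simp: less_max_iff_disj)
qed simp


section \<open>Structural rules\<close>

text \<open>Hypotheses are compared as sets, so exchange and contraction are covered too; this is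
  the persistence on which the use of lists as worlds rests. The larger list stays arbitrary in the
  induction because several rules extend or shift the hypotheses.\<close>

lemma derives_weaken:
  "derives T G p \<Longrightarrow> T \<subseteq> T' \<Longrightarrow> set G \<subseteq> set G' \<Longrightarrow> derives T' G' p"
proof (induction arbitrary: G' rule: derives.induct)
  case (OrE G p q r)
  have "set (p # G) \<subseteq> set (p # G')" "set (q # G) \<subseteq> set (q # G')" using OrE.prems by auto
  then show ?case using OrE.IH OrE.prems derives.OrE by meson
next
  case (ImpI p G q)
  have "set (p # G) \<subseteq> set (p # G')" using ImpI.prems by auto
  then show ?case using ImpI.IH ImpI.prems derives.ImpI by blast
next
  case (AllI G p)
  have "set (map shift G) \<subseteq> set (map shift G')" using AllI.prems by auto
  then show ?case using AllI.IH AllI.prems derives.AllI by blast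
next
  case (ExE G p q)
  have "set (p # map shift G) \<subseteq> set (p # map shift G')" using ExE.prems by auto
  then show ?case using ExE.IH ExE.prems derives.ExE by blast
next
  case (BotE G p)
  then show ?case using derives.BotE by blast
next
  case (AndE1 G p q)
  then show ?case using derives.AndE1 by blast
next
  case (AndE2 G p q)
  then show ?case using derives.AndE2 by blast
next
  case (ImpE G p q)
  then show ?case using derives.ImpE by blast
next
  case (EqE G s t p)
  then show ?case using derives.EqE[of T' G' s t p] by blast
qed (auto intro: derives.Axiom derives.Hyp derives.AndI derives.OrI1 derives.OrI2 derives.AllE
      derives.ExI derives.EqI)

text \<open>With an empty theory the axiom rule disappears, and stability under renaming follows by
  plain induction. The instances of axioms that are used enter as closed hypotheses instead.\<close>

abbreviation entails :: "fm list \<Rightarrow> fm \<Rightarrow> bool" (infix "\<tturnstile>" 20) where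
  "G \<tturnstile> p \<equiv> derives {} G p"

text \<open>Needed to bring a derivation about a fresh variable back under a binder. At the
  quantifier rules the induction hypothesis is taken at \<open>lift_index f\<close>, hence the
  arbitrary \<open>f\<close>.\<close>

lemma entails_rename: "G \<tturnstile> p \<Longrightarrow> map (rename f) G \<tturnstile> rename f p"
proof (induction arbitrary: f rule: derives.induct)
  case (AllI G p)
  from AllI.IH[of "lift_index f"] show ?case
    by (auto intro!: derives.AllI simp: rename_lift_shift comp_def)
next
  case (AllE G p t)
  from derives.AllE[OF AllE.IH[of f, simplified]] show ?case by (simp add: rename_subst)
next
  case (ExI G p t)
  from ExI.IH[of f] show ?case by (auto intro!: derives.ExI simp: rename_subst)
next
  case (ExE G p q)
  from ExE.IH(2)[of "lift_index f"]
  have "rename (lift_index f) p # map shift (map (rename f) G) \<tturnstile> shift (rename f q)"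
    by (simp add: rename_lift_shift comp_def)
  with ExE.IH(1)[of f] show ?case by (auto intro: derives.ExE)
next
  case (EqE G s t p)
  from derives.EqE[of _ _ "f s" "f t" "rename (lift_index f) p"] EqE.IH[of f]
  show ?case by (simp add: rename_subst)
next
  case (OrE G p q r)
  from OrE.IH[of f] show ?case by (auto intro: derives.OrE)
next
  case (ImpI p G q)
  from ImpI.IH[of f] show ?case by (auto intro: derives.ImpI)
next
  case (Hyp p G)
  then show ?case by (auto intro: derives.Hyp)
next
  case (BotE G p)
  from BotE.IH[of f] show ?case by (auto intro: derives.BotE)
next
  case (AndE1 G p q)
  from AndE1.IH[of f] show ?case by (auto intro: derives.AndE1)
next
  case (AndE2 G p q)
  from AndE2.IH[of f] show ?case by (auto intro: derives.AndE2)
next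
  case (ImpE G p q)
  from derives.ImpE[OF ImpE.IH(1)[of f, simplified] ImpE.IH(2)[of f]] show ?case .
qed (auto intro: derives.AndI derives.OrI1 derives.OrI2 derives.EqI)

text \<open>
  A premise required for every variable includes a fresh one, so that the quantifier rules below
  need no freshness condition.
\<close>

lemma fresh_for:
  obtains x where "rename (\<lambda>n. if n = x then 0 else Suc n) (subst p x) = p"
    and "map (rename (\<lambda>n. if n = x then 0 else Suc n)) G = map shift G"
proof -
  obtain m where m: "\<And>f g. (\<forall>i<m. f i = g i) \<Longrightarrow> rename f p = rename g p"
    using rename_cong_below by blast
  obtain n where n:
    "\<forall>f g. (\<forall>i<n. f i = g i) \<longrightarrow> (\<forall>q\<in>set G. rename f q = rename g q)"
    using rename_cong_below_list by blast
  \<comment> \<open>Beyond both bounds, \<open>?x\<close> is fresh for \<open>p\<close> and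
    \<open>G\<close>. The map \<open>?f\<close> sends it to index 0 and shifts all else, so it
    undoes the substitution in \<open>p\<close> and acts as \<open>shift\<close> on
    \<open>G\<close>.\<close>
  let ?x = "max m n"
  let ?f = "\<lambda>n. if n = ?x then 0 else Suc n"
  have id: "rename (\<lambda>n. n) q = q" for q
  proof (induction q)
    case (Forall q)
    have "lift_index (\<lambda>n. n) = (\<lambda>n. n)" by (auto simp: lift_index_def split: nat.split)
    with Forall show ?case by simp
  next
    case (Exists q)
    have "lift_index (\<lambda>n. n) = (\<lambda>n. n)" by (auto simp: lift_index_def split: nat.split)
    with Exists show ?case by simp
  qed simp_all
  have "rename ?f (subst p ?x) = rename (\<lambda>n. n) p"
    unfolding subst_def rename_rename
    by (rule m) (auto split: nat.split)
  moreover have "map (rename ?f) G = map shift G"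
    unfolding shift_def by (rule map_cong[OF refl], rule n[rule_format]) simp_all
  ultimately show ?thesis using that id by simp
qed

section \<open>Quantifier rules without freshness conditions\<close>

lemma allI_eigen:
  assumes "\<And>x. G \<tturnstile> subst p x"
  shows "G \<tturnstile> Forall p"
proof -
  obtain x where "rename (\<lambda>n. if n = x then 0 else Suc n) (subst p x) = p"
    and "map (rename (\<lambda>n. if n = x then 0 else Suc n)) G = map shift G"
    using fresh_for .
  with entails_rename[OF assms[of x], of "\<lambda>n. if n = x then 0 else Suc n"]
  show ?thesis by (auto intro: derives.AllI)
qed

lemma exE_eigen:
  assumes ex: "G \<tturnstile> Exists p"
    and r: "\<And>G' x. set G \<subseteq> set G' \<Longrightarrow> G' \<tturnstile> subst p x \<Longrightarrow> G' \<tturnstile> r"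
  shows "G \<tturnstile> r"
proof -
  \<comment> \<open>The conclusion \<open>r\<close> joins the list so that \<open>x\<close> is fresh
    for it as well, which \<open>ExE\<close> demands.\<close>
  obtain x where x: "rename (\<lambda>n. if n = x then 0 else Suc n) (subst p x) = p"
    "map (rename (\<lambda>n. if n = x then 0 else Suc n)) (r # G) = map shift (r # G)"
    using fresh_for[where p=p and G="r # G"] .
  have "subst p x # G \<tturnstile> r" by (rule r) (auto intro: derives.Hyp)
  from entails_rename[OF this, of "\<lambda>n. if n = x then 0 else Suc n"] x
  have "p # map shift G \<tturnstile> shift r" by (simp cong: map_cong)
  with ex show ?thesis by (rule derives.ExE)
qed

section \<open>Connectives and equality in worlds\<close>

lemma impI_world:
  assumes "\<And>G'. set G \<subseteq> set G' \<Longrightarrow> G' \<tturnstile> p \<Longrightarrow> G' \<tturnstile> q"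
  shows "G \<tturnstile> Imp p q"
  by (rule derives.ImpI, rule assms) (auto intro: derives.Hyp)

lemma orE_world:
  assumes "G \<tturnstile> Or p q"
    and "\<And>G'. set G \<subseteq> set G' \<Longrightarrow> G' \<tturnstile> p \<Longrightarrow> G' \<tturnstile> r"
    and "\<And>G'. set G \<subseteq> set G' \<Longrightarrow> G' \<tturnstile> q \<Longrightarrow> G' \<tturnstile> r"
  shows "G \<tturnstile> r"
  by (rule derives.OrE[OF assms(1)]; rule assms) (auto intro: derives.Hyp)

lemma and_iff: "(G \<tturnstile> And p q) \<longleftrightarrow> (G \<tturnstile> p) \<and> (G \<tturnstile> q)"
  by (meson derives.AndI derives.AndE1 derives.AndE2)

text \<open>Leibniz's rule: in the template given to \<open>EqE\<close>, index 0 is the hole and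
  every other variable is raised by one.\<close>

lemma eq_sym: "G \<tturnstile> Eq x y \<Longrightarrow> G \<tturnstile> Eq y x"
  using derives.EqE[of "{}" G x y "Eq 0 (Suc x)"] by (simp add: subst_def derives.EqI)

lemma eq_trans: "G \<tturnstile> Eq x y \<Longrightarrow> G \<tturnstile> Eq y z \<Longrightarrow> G \<tturnstile> Eq x z"
  using derives.EqE[of "{}" G y z "Eq (Suc x) 0"] by (simp add: subst_def)


section \<open>The notions of the statement as de Bruijn formulas\<close>

abbreviation neg :: "fm \<Rightarrow> fm" where
  "neg p \<equiv> Imp p Bot"

definition ball_fm :: "nat \<Rightarrow> fm \<Rightarrow> fm" where
  "ball_fm a p = Forall (Imp (Mem 0 (Suc a)) p)"

definition bex_fm :: "nat \<Rightarrow> fm \<Rightarrow> fm" where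
  "bex_fm a p = Exists (And (Mem 0 (Suc a)) p)"

lemma rename_ball_bex [simp]:
  "rename f (ball_fm a p) = ball_fm (f a) (rename (lift_index f) p)"
  "rename f (bex_fm a p) = bex_fm (f a) (rename (lift_index f) p)"
  by (simp_all add: ball_fm_def bex_fm_def)

text \<open>The condition \<open>a < d\<close> says that level \<open>a\<close> is already bound. It
  keeps the subtraction from being truncated, so that one more binder raises the index by exactly
  one.\<close>

lemma ballF_eq: "a < d \<Longrightarrow> ballF a P d = ball_fm (d - Suc a) (P d (Suc d))"
  and bexF_eq: "a < d \<Longrightarrow> bexF a P d = bex_fm (d - Suc a) (P d (Suc d))"
  by (simp_all add: ballF_def bexF_def ball_fm_def bex_fm_def allF_def exF_def impF_def andF_def
      memF_def Suc_diff_Suc)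

section \<open>Natural numbers and pairs\<close>

definition empty_fm :: "nat \<Rightarrow> fm" where
  "empty_fm u = ball_fm u Bot"

definition succ_fm :: "nat \<Rightarrow> nat \<Rightarrow> fm" where
  "succ_fm x u = And (Mem x u) (And (ball_fm x (Mem 0 (Suc u)))
     (ball_fm u (Or (Mem 0 (Suc x)) (Eq 0 (Suc x)))))"

definition inductive_fm :: "nat \<Rightarrow> fm" where
  "inductive_fm w = And (bex_fm w (empty_fm 0))
     (ball_fm w (bex_fm (Suc w) (succ_fm (Suc 0) 0)))"

definition omega_fm :: "nat \<Rightarrow> fm" where
  "omega_fm w = And (inductive_fm w)
     (Forall (Imp (inductive_fm 0) (ball_fm (Suc w) (Mem 0 (Suc 0)))))"

definition one_fm :: "nat \<Rightarrow> fm" where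
  "one_fm u = And (bex_fm u (empty_fm 0)) (ball_fm u (empty_fm 0))"

definition index_fm :: "nat \<Rightarrow> nat \<Rightarrow> fm" where
  "index_fm w n = And (Mem n w) (neg (empty_fm n))"

definition upair_fm :: "nat \<Rightarrow> nat \<Rightarrow> nat \<Rightarrow> fm" where
  "upair_fm u x y = And (Mem x u) (And (Mem y u) (ball_fm u (Or (Eq 0 (Suc x)) (Eq 0 (Suc y)))))"

definition opair_fm :: "nat \<Rightarrow> nat \<Rightarrow> nat \<Rightarrow> fm" where
  "opair_fm p x y =
    And (bex_fm p (upair_fm 0 (Suc x) (Suc x))) (And (bex_fm p (upair_fm 0 (Suc x) (Suc y)))
      (ball_fm p (Or (upair_fm 0 (Suc x) (Suc x)) (upair_fm 0 (Suc x) (Suc y)))))"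

section \<open>Relations, apartness and co-quasiorders\<close>

definition rel_fm :: "nat \<Rightarrow> nat \<Rightarrow> nat \<Rightarrow> fm" where
  "rel_fm r x y = bex_fm r (opair_fm 0 (Suc x) (Suc y))"

definition subset_prod_fm :: "nat \<Rightarrow> nat \<Rightarrow> fm" where
  "subset_prod_fm r S =
    ball_fm r (bex_fm (Suc S) (bex_fm (Suc (Suc S)) (opair_fm (Suc (Suc 0)) (Suc 0) 0)))"

definition extensional_fm :: "nat \<Rightarrow> nat \<Rightarrow> nat \<Rightarrow> fm" where
  "extensional_fm S eq r =
    ball_fm S (ball_fm (Suc S) (ball_fm (Suc (Suc S)) (ball_fm (Suc (Suc (Suc S)))
      (Imp (And (rel_fm (Suc (Suc (Suc (Suc eq)))) (Suc (Suc (Suc 0))) (Suc (Suc 0)))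
           (And (rel_fm (Suc (Suc (Suc (Suc eq)))) (Suc 0) 0)
                (rel_fm (Suc (Suc (Suc (Suc r)))) (Suc (Suc (Suc 0))) (Suc 0))))
         (rel_fm (Suc (Suc (Suc (Suc r)))) (Suc (Suc 0)) 0)))))"

definition equivalence_fm :: "nat \<Rightarrow> nat \<Rightarrow> fm" where
  "equivalence_fm S eq =
    And (subset_prod_fm eq S)
    (And (ball_fm S (rel_fm (Suc eq) 0 0))
    (And (ball_fm S (ball_fm (Suc S)
       (Imp (rel_fm (Suc (Suc eq)) (Suc 0) 0) (rel_fm (Suc (Suc eq)) 0 (Suc 0)))))
     (ball_fm S (ball_fm (Suc S) (ball_fm (Suc (Suc S))
       (Imp (And (rel_fm (Suc (Suc (Suc eq))) (Suc (Suc 0)) (Suc 0))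
                 (rel_fm (Suc (Suc (Suc eq))) (Suc 0) 0))
         (rel_fm (Suc (Suc (Suc eq))) (Suc (Suc 0)) 0)))))))"

definition apartness_fm :: "nat \<Rightarrow> nat \<Rightarrow> nat \<Rightarrow> fm" where
  "apartness_fm S eq ap =
    And (subset_prod_fm ap S)
    (And (extensional_fm S eq ap)
    (And (ball_fm S (neg (rel_fm (Suc ap) 0 0)))
    (And (ball_fm S (ball_fm (Suc S)
       (Imp (rel_fm (Suc (Suc ap)) (Suc 0) 0) (rel_fm (Suc (Suc ap)) 0 (Suc 0)))))
     (ball_fm S (ball_fm (Suc S)
       (Imp (rel_fm (Suc (Suc ap)) (Suc 0) 0)
         (ball_fm (Suc (Suc S)) (Or (rel_fm (Suc (Suc (Suc ap))) (Suc (Suc 0)) 0)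
            (rel_fm (Suc (Suc (Suc ap))) 0 (Suc 0))))))))))"

definition set_with_apartness_fm :: "nat \<Rightarrow> nat \<Rightarrow> nat \<Rightarrow> fm" where
  "set_with_apartness_fm S eq ap =
    And (Exists (Mem 0 (Suc S))) (And (equivalence_fm S eq) (apartness_fm S eq ap))"

definition binary_relation_fm :: "nat \<Rightarrow> nat \<Rightarrow> nat \<Rightarrow> fm" where
  "binary_relation_fm S eq r =
    And (Exists (Mem 0 (Suc r))) (And (subset_prod_fm r S) (extensional_fm S eq r))"

definition co_quasiorder_fm :: "nat \<Rightarrow> nat \<Rightarrow> nat \<Rightarrow> nat \<Rightarrow> fm" where
  "co_quasiorder_fm S eq ap \<tau> =
    And (binary_relation_fm S eq \<tau>)
    (And (ball_fm S (ball_fm (Suc S)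
       (Imp (rel_fm (Suc (Suc \<tau>)) (Suc 0) 0) (rel_fm (Suc (Suc ap)) (Suc 0) 0))))
     (ball_fm S (ball_fm (Suc S)
       (Imp (rel_fm (Suc (Suc \<tau>)) (Suc 0) 0)
         (ball_fm (Suc (Suc S)) (Or (rel_fm (Suc (Suc (Suc \<tau>))) (Suc (Suc 0)) 0)
            (rel_fm (Suc (Suc (Suc \<tau>))) 0 (Suc 0))))))))"

section \<open>Binary sequences and the two alternatives of LPO\<close>

definition binary_sequence_fm :: "nat \<Rightarrow> nat \<Rightarrow> fm" where
  "binary_sequence_fm w a =
    And (ball_fm a (Exists (Exists (And (index_fm (Suc (Suc (Suc w))) (Suc 0))
          (And (Or (empty_fm 0) (one_fm 0)) (opair_fm (Suc (Suc 0)) (Suc 0) 0))))))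
      (Forall (Imp (index_fm (Suc w) 0)
        (Exists (And (rel_fm (Suc (Suc a)) (Suc 0) 0)
          (Forall (Imp (rel_fm (Suc (Suc (Suc a))) (Suc (Suc 0)) 0) (Eq 0 (Suc 0))))))))"

definition all_zero_fm :: "nat \<Rightarrow> nat \<Rightarrow> fm" where
  "all_zero_fm w a = Forall (Imp (index_fm (Suc w) 0)
     (Exists (And (empty_fm 0) (rel_fm (Suc (Suc a)) (Suc 0) 0))))"

definition some_one_fm :: "nat \<Rightarrow> nat \<Rightarrow> fm" where
  "some_one_fm w a = Exists (And (index_fm (Suc w) 0)
     (Exists (And (one_fm 0) (rel_fm (Suc (Suc a)) (Suc 0) 0))))"

section \<open>Compatibility of the notions with renaming\<close>

lemma rename_basic [simp]:
  "rename f (empty_fm x) = empty_fm (f x)"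
  "rename f (succ_fm x y) = succ_fm (f x) (f y)"
  "rename f (upair_fm x y z) = upair_fm (f x) (f y) (f z)"
  "rename f (index_fm x y) = index_fm (f x) (f y)"
  by (simp_all add: empty_fm_def succ_fm_def upair_fm_def index_fm_def)

text \<open>Each layer uses the equations of the layers before it, so that no notion is unfolded
  more than one level deep. Instances of quantified formulas are later computed from these equations
  and \<open>subst_def\<close>.\<close>

lemma rename_pair [simp]:
  "rename f (one_fm x) = one_fm (f x)"
  "rename f (inductive_fm x) = inductive_fm (f x)"
  "rename f (opair_fm x y z) = opair_fm (f x) (f y) (f z)"
  by (simp_all add: one_fm_def inductive_fm_def opair_fm_def)

lemma rename_rel [simp]:
  "rename f (omega_fm x) = omega_fm (f x)"
  "rename f (rel_fm x y z) = rel_fm (f x) (f y) (f z)"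
  "rename f (subset_prod_fm x y) = subset_prod_fm (f x) (f y)"
  by (simp_all add: omega_fm_def rel_fm_def subset_prod_fm_def)

lemma rename_structure [simp]:
  "rename f (extensional_fm x y z) = extensional_fm (f x) (f y) (f z)"
  "rename f (equivalence_fm x y) = equivalence_fm (f x) (f y)"
  "rename f (binary_sequence_fm x y) = binary_sequence_fm (f x) (f y)"
  "rename f (all_zero_fm x y) = all_zero_fm (f x) (f y)"
  "rename f (some_one_fm x y) = some_one_fm (f x) (f y)"
  by (simp_all add: extensional_fm_def equivalence_fm_def binary_sequence_fm_def all_zero_fm_def
      some_one_fm_def)

lemma rename_apartness [simp]:
  "rename f (apartness_fm x y z) = apartness_fm (f x) (f y) (f z)"
  "rename f (binary_relation_fm x y z) = binary_relation_fm (f x) (f y) (f z)"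
  by (simp_all add: apartness_fm_def binary_relation_fm_def)

lemma rename_apartness_set [simp]:
  "rename f (set_with_apartness_fm x y z) = set_with_apartness_fm (f x) (f y) (f z)"
  "rename f (co_quasiorder_fm x y z t) = co_quasiorder_fm (f x) (f y) (f z) (f t)"
  by (simp_all add: set_with_apartness_fm_def co_quasiorder_fm_def)

section \<open>Agreement with the notation by binding levels\<close>

lemmas connective_defs =
  andF_def orF_def impF_def notF_def falseF_def memF_def eqF_def allF_def exF_def

lemma basic_eq_fm [simp]:
  "x < d \<Longrightarrow>
     emptyF x d = empty_fm (d - Suc x)"
  "x < d \<Longrightarrow> y < d \<Longrightarrow>
     succF x y d = succ_fm (d - Suc x) (d - Suc y)"
  "x < d \<Longrightarrow> y < d \<Longrightarrow> z < d \<Longrightarrow>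
     upairF x y z d = upair_fm (d - Suc x) (d - Suc y) (d - Suc z)"
  "x < d \<Longrightarrow> y < d \<Longrightarrow>
     index x y d = index_fm (d - Suc x) (d - Suc y)"
  by (simp_all add: ballF_eq bexF_eq connective_defs Suc_diff_Suc Suc_diff_le eval_nat_numeral
      emptyF_def empty_fm_def succF_def succ_fm_def upairF_def upair_fm_def index_def index_fm_def)

lemma pair_eq_fm [simp]:
  "x < d \<Longrightarrow>
     oneF x d = one_fm (d - Suc x)"
  "x < d \<Longrightarrow>
     inductiveF x d = inductive_fm (d - Suc x)"
  "x < d \<Longrightarrow> y < d \<Longrightarrow> z < d \<Longrightarrow>
     opairF x y z d = opair_fm (d - Suc x) (d - Suc y) (d - Suc z)"
  by (simp_all add: ballF_eq bexF_eq connective_defs Suc_diff_Suc Suc_diff_le eval_nat_numeral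
      oneF_def one_fm_def inductiveF_def inductive_fm_def opairF_def opair_fm_def)

lemma rel_eq_fm [simp]:
  "x < d \<Longrightarrow>
     omegaF x d = omega_fm (d - Suc x)"
  "x < d \<Longrightarrow> y < d \<Longrightarrow> z < d \<Longrightarrow>
     relF x y z d = rel_fm (d - Suc x) (d - Suc y) (d - Suc z)"
  "x < d \<Longrightarrow> y < d \<Longrightarrow>
     subset_prodF x y d = subset_prod_fm (d - Suc x) (d - Suc y)"
  by (simp_all add: ballF_eq bexF_eq connective_defs Suc_diff_Suc Suc_diff_le eval_nat_numeral
      omegaF_def omega_fm_def relF_def rel_fm_def subset_prodF_def subset_prod_fm_def)

lemma structure_eq_fm [simp]:
  "x < d \<Longrightarrow> y < d \<Longrightarrow> z < d \<Longrightarrow>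
     extensionalF x y z d = extensional_fm (d - Suc x) (d - Suc y) (d - Suc z)"
  "x < d \<Longrightarrow> y < d \<Longrightarrow>
     equivalenceF x y d = equivalence_fm (d - Suc x) (d - Suc y)"
  "x < d \<Longrightarrow> y < d \<Longrightarrow>
     binary_sequence x y d = binary_sequence_fm (d - Suc x) (d - Suc y)"
  by (simp_all add: ballF_eq bexF_eq connective_defs Suc_diff_Suc Suc_diff_le eval_nat_numeral
      extensionalF_def extensional_fm_def equivalenceF_def equivalence_fm_def
      binary_sequence_def binary_sequence_fm_def)

lemma apartness_eq_fm [simp]:
  "x < d \<Longrightarrow> y < d \<Longrightarrow> z < d \<Longrightarrow>
     apartnessF x y z d = apartness_fm (d - Suc x) (d - Suc y) (d - Suc z)"
  "x < d \<Longrightarrow> y < d \<Longrightarrow> z < d \<Longrightarrow>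
     binary_relation x y z d = binary_relation_fm (d - Suc x) (d - Suc y) (d - Suc z)"
  by (simp_all add: ballF_eq bexF_eq connective_defs Suc_diff_Suc Suc_diff_le eval_nat_numeral
      apartnessF_def apartness_fm_def binary_relation_def binary_relation_fm_def)

lemma apartness_set_eq_fm [simp]:
  "x < d \<Longrightarrow> y < d \<Longrightarrow> z < d \<Longrightarrow>
     set_with_apartness x y z d = set_with_apartness_fm (d - Suc x) (d - Suc y) (d - Suc z)"
  "x < d \<Longrightarrow> y < d \<Longrightarrow> z < d \<Longrightarrow> t < d \<Longrightarrow>
     co_quasiorder x y z t d = co_quasiorder_fm (d - Suc x) (d - Suc y) (d - Suc z) (d - Suc t)"
  by (simp_all add: ballF_eq bexF_eq connective_defs Suc_diff_Suc Suc_diff_le eval_nat_numeral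
      set_with_apartness_def set_with_apartness_fm_def co_quasiorder_def co_quasiorder_fm_def)

text \<open>Two binders deep, \<open>w\<close> and \<open>a\<close> have indices
  \<open>Suc 0\<close> and 0.\<close>

lemma LPO_eq: "LPO 0 = Forall (Forall (Imp (And (omega_fm (Suc 0)) (binary_sequence_fm (Suc 0) 0))
    (Or (all_zero_fm (Suc 0) 0) (some_one_fm (Suc 0) 0))))"
  by (simp add: LPO_def connective_defs eval_nat_numeral all_zero_fm_def some_one_fm_def)


section \<open>Bounded quantifiers and pairs\<close>

lemmas weaken = derives_weaken[OF _ subset_refl]

lemma ballI_world:
  assumes "\<And>G' x. set G \<subseteq> set G' \<Longrightarrow> G' \<tturnstile> Mem x a \<Longrightarrow> G' \<tturnstile> subst p x"
  shows "G \<tturnstile> ball_fm a p"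
  unfolding ball_fm_def
proof (rule allI_eigen)
  fix x
  have "G \<tturnstile> Imp (Mem x a) (subst p x)" by (rule impI_world) (rule assms)
  then show "G \<tturnstile> subst (Imp (Mem 0 (Suc a)) p) x" by (simp add: subst_def)
qed

lemma ballE: "G \<tturnstile> ball_fm a p \<Longrightarrow> G \<tturnstile> Mem x a \<Longrightarrow> G \<tturnstile> subst p x"
  using derives.AllE[of "{}" G "Imp (Mem 0 (Suc a)) p" x]
  by (auto simp: ball_fm_def subst_def intro: derives.ImpE)

lemma bexI: "G \<tturnstile> Mem x a \<Longrightarrow> G \<tturnstile> subst p x \<Longrightarrow> G \<tturnstile> bex_fm a p"
  unfolding bex_fm_def by (rule derives.ExI[where t=x]) (simp add: subst_def and_iff)

lemma bexE:
  assumes "G \<tturnstile> bex_fm a p"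
    and "\<And>G' x. set G \<subseteq> set G' \<Longrightarrow> G' \<tturnstile> Mem x a \<Longrightarrow> G' \<tturnstile> subst p x \<Longrightarrow> G' \<tturnstile> r"
  shows "G \<tturnstile> r"
  using assms(1) unfolding bex_fm_def
  by (rule exE_eigen) (rule assms(2), auto simp: subst_def and_iff)

section \<open>Unordered pairs\<close>

lemma upair_mem: "G \<tturnstile> upair_fm u x y \<Longrightarrow> G \<tturnstile> Mem x u" "G \<tturnstile> upair_fm u x y \<Longrightarrow> G \<tturnstile> Mem y u"
  by (simp_all add: upair_fm_def and_iff)

lemma upair_cases: "G \<tturnstile> upair_fm u x y \<Longrightarrow> G \<tturnstile> Mem v u \<Longrightarrow> G \<tturnstile> Or (Eq v x) (Eq v y)"
  using ballE[of G u "Or (Eq 0 (Suc x)) (Eq 0 (Suc y))" v]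
  by (simp add: upair_fm_def and_iff subst_def)

lemma upair_single: "G \<tturnstile> upair_fm u x x \<Longrightarrow> G \<tturnstile> Mem v u \<Longrightarrow> G \<tturnstile> Eq v x"
  by (rule orE_world[OF upair_cases])

text \<open>Every member of \<open>u\<close> equals \<open>x\<close> or \<open>y\<close>, and
  Leibniz's rule carries the property over to it. This later turns quantifiers over the two-point
  set into finite checks.\<close>

lemma upair_ball:
  assumes "G \<tturnstile> upair_fm u x y"
  shows "(G \<tturnstile> ball_fm u p) \<longleftrightarrow> (G \<tturnstile> subst p x) \<and> (G \<tturnstile> subst p y)"
proof safe
  assume "G \<tturnstile> ball_fm u p"
  then show "G \<tturnstile> subst p x" "G \<tturnstile> subst p y" using upair_mem[OF assms] by (auto intro: ballE)
next
  assume px: "G \<tturnstile> subst p x" and py: "G \<tturnstile> subst p y"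
  show "G \<tturnstile> ball_fm u p"
  proof (rule ballI_world)
    fix G' v assume G': "set G \<subseteq> set G'" and v: "G' \<tturnstile> Mem v u"
    show "G' \<tturnstile> subst p v"
    proof (rule orE_world[OF upair_cases[OF weaken[OF assms G'] v]])
      fix G'' assume G'': "set G' \<subseteq> set G''" and "G'' \<tturnstile> Eq v x"
      moreover have "G'' \<tturnstile> subst p x" using weaken[OF weaken[OF px G'] G''] .
      ultimately show "G'' \<tturnstile> subst p v" by (meson eq_sym derives.EqE)
    next
      fix G'' assume G'': "set G' \<subseteq> set G''" and "G'' \<tturnstile> Eq v y"
      moreover have "G'' \<tturnstile> subst p y" using weaken[OF weaken[OF py G'] G''] .
      ultimately show "G'' \<tturnstile> subst p v" by (meson eq_sym derives.EqE)
    qed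
  qed
qed

section \<open>Kuratowski pairs\<close>

lemma opairE:
  assumes "G \<tturnstile> opair_fm p x y"
    and "\<And>G' s t. set G \<subseteq> set G' \<Longrightarrow> G' \<tturnstile> Mem s p \<Longrightarrow> G' \<tturnstile> upair_fm s x x \<Longrightarrow>
      G' \<tturnstile> Mem t p \<Longrightarrow> G' \<tturnstile> upair_fm t x y \<Longrightarrow> G' \<tturnstile> r"
  shows "G \<tturnstile> r"
proof -
  have "G \<tturnstile> bex_fm p (upair_fm 0 (Suc x) (Suc x))" "G \<tturnstile> bex_fm p (upair_fm 0 (Suc x) (Suc y))"
    using assms(1) by (simp_all add: opair_fm_def and_iff)
  note ex = this
  show ?thesis
  proof (rule bexE[OF ex(1)], goal_cases)
    case (1 G1 s)
    show ?case
    proof (rule bexE[OF weaken[OF ex(2) 1(1)]], goal_cases)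
      case (1 G2 t)
      with \<open>set G \<subseteq> set G1\<close> \<open>G1 \<tturnstile> Mem s p\<close> \<open>G1 \<tturnstile> subst _ s\<close> show ?case
        by (intro assms(2)[of G2 s t]) (auto simp: subst_def intro: weaken)
    qed
  qed
qed

lemma opair_cases:
  assumes "G \<tturnstile> opair_fm p x y" "G \<tturnstile> Mem s p"
  shows "G \<tturnstile> Or (upair_fm s x x) (upair_fm s x y)"
  using ballE[of G p "Or (upair_fm 0 (Suc x) (Suc x)) (upair_fm 0 (Suc x) (Suc y))" s] assms
  by (simp add: opair_fm_def and_iff subst_def)

text \<open>The member {x} of \<open>p\<close> is {x'} or {x', y'}; in either case x' lies in
  {x}.\<close>

lemma opair_inject_fst:
  assumes "G \<tturnstile> opair_fm p x y" "G \<tturnstile> opair_fm p x' y'"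
  shows "G \<tturnstile> Eq x x'"
proof (rule opairE[OF assms(1)])
  fix G' s assume G': "set G \<subseteq> set G'" and s: "G' \<tturnstile> Mem s p" "G' \<tturnstile> upair_fm s x x"
  show "G' \<tturnstile> Eq x x'"
  proof (rule orE_world[OF opair_cases[OF weaken[OF assms(2) G'] s(1)]])
    fix G'' assume "set G' \<subseteq> set G''" "G'' \<tturnstile> upair_fm s x' x'"
    then show "G'' \<tturnstile> Eq x x'" by (meson upair_single upair_mem s(2) weaken eq_sym)
  next
    fix G'' assume "set G' \<subseteq> set G''" "G'' \<tturnstile> upair_fm s x' y'"
    then show "G'' \<tturnstile> Eq x x'" by (meson upair_single upair_mem s(2) weaken eq_sym)
  qed
qed

text \<open>The member {x, y} of \<open>p\<close> is {x'} or {x', y'}, and y lies in it. This is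
  weaker than injectivity, but it can be applied in both directions.\<close>

lemma opair_snd_cases:
  assumes "G \<tturnstile> opair_fm p x y" "G \<tturnstile> opair_fm p x' y'"
  shows "G \<tturnstile> Or (Eq y x') (Eq y y')"
proof (rule opairE[OF assms(1)])
  fix G' s t assume G': "set G \<subseteq> set G'" and t: "G' \<tturnstile> Mem t p" "G' \<tturnstile> upair_fm t x y"
  have y: "G' \<tturnstile> Mem y t" using t(2) by (rule upair_mem)
  show "G' \<tturnstile> Or (Eq y x') (Eq y y')"
  proof (rule orE_world[OF opair_cases[OF weaken[OF assms(2) G'] t(1)]])
    fix G'' assume "set G' \<subseteq> set G''" "G'' \<tturnstile> upair_fm t x' x'"
    then show "G'' \<tturnstile> Or (Eq y x') (Eq y y')" by (meson upair_single y weaken derives.OrI1)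
  next
    fix G'' assume "set G' \<subseteq> set G''" "G'' \<tturnstile> upair_fm t x' y'"
    then show "G'' \<tturnstile> Or (Eq y x') (Eq y y')" by (meson upair_cases y weaken)
  qed
qed

text \<open>Splitting cases in both directions leaves only y = x' together with y' = x, where
  equality of the first coordinates gives y = x' = x = y'.\<close>

lemma opair_inject_snd:
  assumes p: "G \<tturnstile> opair_fm p x y" and p': "G \<tturnstile> opair_fm p x' y'"
  shows "G \<tturnstile> Eq y y'"
proof (rule orE_world[OF opair_snd_cases[OF p p']])
  fix G1 assume G1: "set G \<subseteq> set G1" and y: "G1 \<tturnstile> Eq y x'"
  note p1 = weaken[OF p G1] weaken[OF p' G1]
  show "G1 \<tturnstile> Eq y y'"
  proof (rule orE_world[OF opair_snd_cases[OF p1(2,1)]])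
    fix G2 assume G2: "set G1 \<subseteq> set G2" and "G2 \<tturnstile> Eq y' x"
    moreover have "G2 \<tturnstile> Eq x x'" "G2 \<tturnstile> Eq y x'"
      using opair_inject_fst[OF p1] y G2 by (auto intro: weaken)
    ultimately show "G2 \<tturnstile> Eq y y'" by (meson eq_sym eq_trans)
  qed (rule eq_sym)
qed

lemma opair_eq:
  assumes "G \<tturnstile> Eq p p'" "G \<tturnstile> opair_fm p x y"
  shows "G \<tturnstile> opair_fm p' x y"
  using derives.EqE[OF assms(1), of "opair_fm 0 (Suc x) (Suc y)"] assms(2) by (simp add: subst_def)

section \<open>Relations as sets of pairs\<close>

lemma relI: "G \<tturnstile> Mem p r \<Longrightarrow> G \<tturnstile> opair_fm p x y \<Longrightarrow> G \<tturnstile> rel_fm r x y"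
  unfolding rel_fm_def by (rule bexI[where x=p]) (simp_all add: subst_def)

lemma relE:
  assumes "G \<tturnstile> rel_fm r x y"
    and "\<And>G' p. set G \<subseteq> set G' \<Longrightarrow> G' \<tturnstile> Mem p r \<Longrightarrow> G' \<tturnstile> opair_fm p x y \<Longrightarrow> G' \<tturnstile> q"
  shows "G \<tturnstile> q"
  using assms(1) unfolding rel_fm_def
  by (rule bexE) (rule assms(2), simp_all add: subst_def)

text \<open>Injectivity of pairs turns membership in a relation with two listed pairs into equations
  between coordinates. It serves to refute instances of \<open>eq\<close> and
  \<open>ap\<close>.\<close>

lemma rel_upairE:
  assumes R: "G \<tturnstile> upair_fm R p p'" and p: "G \<tturnstile> opair_fm p x y" "G \<tturnstile> opair_fm p' x' y'"
    and ab: "G \<tturnstile> rel_fm R a b"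
    and r: "\<And>G'. set G \<subseteq> set G' \<Longrightarrow> G' \<tturnstile> Eq a x \<Longrightarrow> G' \<tturnstile> Eq b y \<Longrightarrow> G' \<tturnstile> r"
      "\<And>G'. set G \<subseteq> set G' \<Longrightarrow> G' \<tturnstile> Eq a x' \<Longrightarrow> G' \<tturnstile> Eq b y' \<Longrightarrow> G' \<tturnstile> r"
  shows "G \<tturnstile> r"
proof (rule relE[OF ab])
  fix G1 q assume G1: "set G \<subseteq> set G1" and q: "G1 \<tturnstile> Mem q R" "G1 \<tturnstile> opair_fm q a b"
  show "G1 \<tturnstile> r"
  proof (rule orE_world[OF upair_cases[OF weaken[OF R G1] q(1)]])
    fix G2 assume G2: "set G1 \<subseteq> set G2" and "G2 \<tturnstile> Eq q p"
    then have "G2 \<tturnstile> opair_fm p a b" "G2 \<tturnstile> opair_fm p x y"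
      using q(2) p(1) G1 by (auto intro: opair_eq weaken)
    then show "G2 \<tturnstile> r"
      using G1 G2 by (intro r(1)) (auto intro: opair_inject_fst opair_inject_snd)
  next
    fix G2 assume G2: "set G1 \<subseteq> set G2" and "G2 \<tturnstile> Eq q p'"
    then have "G2 \<tturnstile> opair_fm p' a b" "G2 \<tturnstile> opair_fm p' x' y'"
      using q(2) p(2) G1 by (auto intro: opair_eq weaken)
    then show "G2 \<tturnstile> r"
      using G1 G2 by (intro r(2)) (auto intro: opair_inject_fst opair_inject_snd)
  qed
qed


text \<open>These close the implications that remain after the quantifiers over two points are
  expanded: the antecedent is refuted, the consequent is already derived, or the consequent repeats
  the antecedent or part of it.\<close>

lemma imp_intros:
  "G \<tturnstile> neg p \<Longrightarrow> G \<tturnstile> Imp p p'"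
  "G \<tturnstile> neg p \<Longrightarrow> G \<tturnstile> neg (And p p')"
  "G \<tturnstile> neg p' \<Longrightarrow> G \<tturnstile> neg (And p p')"
  "G \<tturnstile> p' \<Longrightarrow> G \<tturnstile> Imp p p'"
  "G \<tturnstile> Imp (And p (And p' p'')) p''"
  "G \<tturnstile> Imp p (Or p p')" "G \<tturnstile> Imp p (Or p' p)"
  by - (rule impI_world,
      meson and_iff derives.BotE derives.ImpE derives.OrI1 derives.OrI2 weaken)+

section \<open>The two-point set with apartness\<close>

text \<open>
  \<open>u\<close> and \<open>v\<close> play the roles of 0 and 1. The pairs are \<open>p\<^sub>0 = (u, u)\<close>, \<open>p\<^sub>1 = (v, v)\<close>,
  \<open>q = (u, v)\<close> and \<open>r = (v, u)\<close>.
\<close>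

context
  fixes u v S eq ap \<tau> p\<^sub>0 p\<^sub>1 q r :: nat and \<phi> :: fm
begin

text \<open>The last clause is what separation from \<open>ap\<close> provides: \<open>r\<close> is
  always kept, the other pair only under \<open>\<phi>\<close>. It is stated for all variables
  \<open>x\<close> outside the object language, so that each instance can be used directly.\<close>

definition two_point :: "fm list \<Rightarrow> bool" where
  "two_point G \<longleftrightarrow>
    (G \<tturnstile> neg (Eq u v)) \<and> (G \<tturnstile> upair_fm S u v) \<and>
    (G \<tturnstile> opair_fm p\<^sub>0 u u) \<and> (G \<tturnstile> opair_fm p\<^sub>1 v v) \<and>
    (G \<tturnstile> opair_fm q u v) \<and> (G \<tturnstile> opair_fm r v u) \<and>
    (G \<tturnstile> upair_fm eq p\<^sub>0 p\<^sub>1) \<and> (G \<tturnstile> upair_fm ap q r) \<and>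
    (\<forall>x. (G \<tturnstile> Imp (Mem x \<tau>) (And (Mem x ap) (Or (Eq x r) \<phi>))) \<and>
         (G \<tturnstile> Imp (And (Mem x ap) (Or (Eq x r) \<phi>)) (Mem x \<tau>)))"

lemma two_point_weaken: "two_point G \<Longrightarrow> set G \<subseteq> set G' \<Longrightarrow> two_point G'"
  unfolding two_point_def by (auto intro: weaken)

lemma two_point_distinct: "two_point G \<Longrightarrow> G \<tturnstile> Eq u v \<Longrightarrow> G \<tturnstile> \<psi>"
  "two_point G \<Longrightarrow> G \<tturnstile> Eq v u \<Longrightarrow> G \<tturnstile> \<psi>"
  unfolding two_point_def by (meson derives.BotE derives.ImpE eq_sym)+

lemma two_point_tau_iff:
  assumes "two_point G"
  shows "(G \<tturnstile> Mem x \<tau>) \<longleftrightarrow> (G \<tturnstile> Mem x ap) \<and> (G \<tturnstile> Or (Eq x r) \<phi>)"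
  using assms unfolding two_point_def by (meson derives.ImpE and_iff)

lemma two_point_rel:
  assumes "two_point G"
  shows "G \<tturnstile> rel_fm eq u u" "G \<tturnstile> rel_fm eq v v" "G \<tturnstile> rel_fm ap u v" "G \<tturnstile> rel_fm ap v u"
    "G \<tturnstile> rel_fm \<tau> v u"
proof -
  \<comment> \<open>Since \<open>r\<close> satisfies the left disjunct, \<open>\<tau>\<close> is
    inhabited whatever the status of \<open>\<phi>\<close>.\<close>
  have r: "G \<tturnstile> Mem r \<tau>"
    using assms unfolding two_point_tau_iff[OF assms] two_point_def
    by (auto intro: upair_mem derives.OrI1 derives.EqI)
  show "G \<tturnstile> rel_fm eq u u" "G \<tturnstile> rel_fm eq v v" "G \<tturnstile> rel_fm ap u v" "G \<tturnstile> rel_fm ap v u"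
    "G \<tturnstile> rel_fm \<tau> v u"
    using assms r unfolding two_point_def by (meson relI upair_mem)+
qed

lemma two_point_tau_ap:
  assumes "two_point G" "G \<tturnstile> rel_fm \<tau> x y"
  shows "G \<tturnstile> rel_fm ap x y"
  using assms(2)
proof (rule relE)
  fix G' p assume "set G \<subseteq> set G'" "G' \<tturnstile> Mem p \<tau>" "G' \<tturnstile> opair_fm p x y"
  then show "G' \<tturnstile> rel_fm ap x y"
    using two_point_tau_iff[OF two_point_weaken[OF assms(1)]] by (blast intro: relI)
qed

text \<open>Comparing coordinates with the listed pairs would force u = v in each case;
  \<open>\<tau>\<close> inherits irreflexivity from \<open>ap\<close>. The auxiliary facts hold at
  arbitrary worlds because a negation is proved at all larger ones.\<close>

lemma two_point_not_rel:
  assumes "two_point G"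
  shows "G \<tturnstile> neg (rel_fm eq u v)" "G \<tturnstile> neg (rel_fm eq v u)"
    "G \<tturnstile> neg (rel_fm ap u u)" "G \<tturnstile> neg (rel_fm ap v v)"
    "G \<tturnstile> neg (rel_fm \<tau> u u)" "G \<tturnstile> neg (rel_fm \<tau> v v)"
proof -
  have eq: "G' \<tturnstile> Bot" if tp: "two_point G'" and xy: "G' \<tturnstile> rel_fm eq x y"
    "x = u \<and> y = v \<or> x = v \<and> y = u" for G' x y
  proof -
    have "G' \<tturnstile> upair_fm eq p\<^sub>0 p\<^sub>1" "G' \<tturnstile> opair_fm p\<^sub>0 u u" "G' \<tturnstile> opair_fm p\<^sub>1 v v"
      using tp by (simp_all add: two_point_def)
    then show ?thesis using xy(1)
      by (rule rel_upairE) (use xy(2) two_point_distinct two_point_weaken[OF tp] in blast)+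
  qed
  have ap: "G' \<tturnstile> Bot" if tp: "two_point G'" and x: "G' \<tturnstile> rel_fm ap x x" "x = u \<or> x = v" for G' x
  proof -
    have "G' \<tturnstile> upair_fm ap q r" "G' \<tturnstile> opair_fm q u v" "G' \<tturnstile> opair_fm r v u"
      using tp by (simp_all add: two_point_def)
    then show ?thesis using x(1)
      by (rule rel_upairE) (use x(2) two_point_distinct two_point_weaken[OF tp] in blast)+
  qed
  have neg: "G \<tturnstile> neg p" if "\<And>G'. two_point G' \<Longrightarrow> G' \<tturnstile> p \<Longrightarrow> G' \<tturnstile> Bot" for p
    by (rule impI_world) (rule that[OF two_point_weaken[OF assms]])
  show "G \<tturnstile> neg (rel_fm eq u v)" "G \<tturnstile> neg (rel_fm eq v u)"
    by (rule neg, rule eq, assumption, assumption, simp)+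
  show "G \<tturnstile> neg (rel_fm ap u u)" "G \<tturnstile> neg (rel_fm ap v v)"
    by (rule neg, rule ap, assumption, assumption, simp)+
  show "G \<tturnstile> neg (rel_fm \<tau> u u)" "G \<tturnstile> neg (rel_fm \<tau> v v)"
    by (rule neg, rule ap[OF _ two_point_tau_ap], assumption, assumption, assumption, simp)+
qed

text \<open>A pair (u, v) equal to \<open>r\<close> would give u = v, so it can lie in
  \<open>\<tau>\<close> only through the disjunct \<open>\<phi>\<close>; conversely \<open>q\<close>
  lies in \<open>ap\<close>.\<close>

lemma two_point_tau_decides:
  assumes "two_point G"
  shows "(G \<tturnstile> rel_fm \<tau> u v) \<longleftrightarrow> (G \<tturnstile> \<phi>)"
proof
  assume "G \<tturnstile> rel_fm \<tau> u v"
  then show "G \<tturnstile> \<phi>"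
  proof (rule relE)
    fix G1 p assume G1: "set G \<subseteq> set G1" and p: "G1 \<tturnstile> Mem p \<tau>" "G1 \<tturnstile> opair_fm p u v"
    have tp: "two_point G1" using two_point_weaken[OF assms G1] .
    then have "G1 \<tturnstile> Or (Eq p r) \<phi>" using p by (simp add: two_point_tau_iff)
    then show "G1 \<tturnstile> \<phi>"
    proof (rule orE_world)
      fix G2 assume G2: "set G1 \<subseteq> set G2" and pr: "G2 \<tturnstile> Eq p r"
      have tp2: "two_point G2" using two_point_weaken[OF tp G2] .
      have "G2 \<tturnstile> opair_fm r u v" using opair_eq[OF pr] p(2) G2 by (auto intro: weaken)
      moreover have "G2 \<tturnstile> opair_fm r v u" using tp2 by (simp add: two_point_def)
      ultimately have "G2 \<tturnstile> Eq u v" by (rule opair_inject_fst)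
      then show "G2 \<tturnstile> \<phi>" by (rule two_point_distinct(1)[OF tp2])
    qed
  qed
next
  assume "G \<tturnstile> \<phi>"
  moreover have "G \<tturnstile> Mem q ap" "G \<tturnstile> opair_fm q u v"
    using assms by (auto simp: two_point_def intro: upair_mem)
  ultimately show "G \<tturnstile> rel_fm \<tau> u v"
    using two_point_tau_iff[OF assms] by (meson relI derives.OrI2)
qed

section \<open>Verification of the structure on two points\<close>

lemma two_point_ball:
  "two_point G \<Longrightarrow> (G \<tturnstile> ball_fm S p) \<longleftrightarrow> (G \<tturnstile> subst p u) \<and> (G \<tturnstile> subst p v)"
  by (rule upair_ball) (simp add: two_point_def)

text \<open>In co-transitivity the quantifier over the third point stands behind an implication.
  Moving the antecedent into the world, where \<open>two_point\<close> persists, makes the expansion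
  available there.\<close>

lemma two_point_imp_ball:
  assumes "two_point G"
  shows "(G \<tturnstile> Imp p (ball_fm S p')) \<longleftrightarrow> (G \<tturnstile> Imp p (subst p' u)) \<and> (G \<tturnstile> Imp p (subst p' v))"
proof -
  have "two_point (p # G)" by (rule two_point_weaken[OF assms]) auto
  moreover have "(G \<tturnstile> Imp p p'') \<longleftrightarrow> (p # G \<tturnstile> p'')" for p''
    by (meson derives.ImpI derives.ImpE derives.Hyp list.set_intros(1) weaken set_subset_Cons)
  ultimately show ?thesis by (simp add: two_point_ball)
qed

text \<open>For \<open>eq\<close> and \<open>ap\<close> this is a check of two listed pairs, while
  \<open>\<tau>\<close> is contained in \<open>ap\<close>.\<close>

lemma subset_prod_two_point:
  assumes tp: "two_point G"
  shows "G \<tturnstile> subset_prod_fm eq S" "G \<tturnstile> subset_prod_fm ap S" "G \<tturnstile> subset_prod_fm \<tau> S"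
proof -
  note [simp] = tp[unfolded two_point_def]
  have S: "G \<tturnstile> Mem u S" "G \<tturnstile> Mem v S" using upair_mem[of G S u v] by simp_all
  have bex2: "G \<tturnstile> bex_fm S (bex_fm (Suc S) (opair_fm (Suc (Suc p)) (Suc 0) 0))"
    if "G \<tturnstile> Mem x S" "G \<tturnstile> Mem y S" "G \<tturnstile> opair_fm p x y" for p x y
    by (rule bexI[OF that(1)], simp add: subst_def, rule bexI[OF that(2)], simp add: subst_def that)
  show "G \<tturnstile> subset_prod_fm eq S" unfolding subset_prod_fm_def
    by (subst upair_ball[where x=p\<^sub>0 and y=p\<^sub>1]) (auto simp: subst_def intro: bex2 S)
  show ap: "G \<tturnstile> subset_prod_fm ap S" unfolding subset_prod_fm_def
    by (subst upair_ball[where x=q and y=r])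
      (auto simp: subst_def intro: bex2[of u v] bex2[of v u] S)
  show "G \<tturnstile> subset_prod_fm \<tau> S" unfolding subset_prod_fm_def
  proof (rule ballI_world)
    fix G' x assume G': "set G \<subseteq> set G'" and "G' \<tturnstile> Mem x \<tau>"
    then have "G' \<tturnstile> Mem x ap" using two_point_weaken[OF tp G'] by (simp add: two_point_tau_iff)
    with weaken[OF ap G'] show "G' \<tturnstile> subst (bex_fm (Suc S)
      (bex_fm (Suc (Suc S)) (opair_fm (Suc (Suc 0)) (Suc 0) 0))) x"
      unfolding subset_prod_fm_def by (rule ballE)
  qed
qed

lemma two_point_set_with_apartness:
  assumes tp: "two_point G"
  shows "G \<tturnstile> set_with_apartness_fm S eq ap"
proof -
  note rules = imp_intros derives.OrI1 derives.OrI2 two_point_rel[OF tp] two_point_not_rel[OF tp]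
  note simps = and_iff two_point_ball[OF tp] two_point_imp_ball[OF tp] subst_def
  have "G \<tturnstile> Exists (Mem 0 (Suc S))"
    by (rule derives.ExI[where t=u])
      (use tp in \<open>auto simp: subst_def two_point_def intro: upair_mem\<close>)
  moreover have "G \<tturnstile> equivalence_fm S eq" unfolding equivalence_fm_def
    by (simp add: simps subset_prod_two_point[OF tp]) (blast intro: rules)
  moreover have "G \<tturnstile> apartness_fm S eq ap" unfolding apartness_fm_def extensional_fm_def
    by (simp add: simps subset_prod_two_point[OF tp]) (blast intro: rules)
  ultimately show ?thesis by (simp add: set_with_apartness_fm_def and_iff)
qed

text \<open>For co-transitivity at distinct points, the third point is one of the two, so one
  disjunct is the antecedent itself; at equal points the antecedent is refuted. Nothing here
  requires \<open>\<phi>\<close> to be decided.\<close>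

lemma two_point_co_quasiorder:
  assumes tp: "two_point G"
  shows "G \<tturnstile> co_quasiorder_fm S eq ap \<tau>"
proof -
  note rules = imp_intros derives.OrI1 derives.OrI2 two_point_rel[OF tp] two_point_not_rel[OF tp]
  note simps = and_iff two_point_ball[OF tp] two_point_imp_ball[OF tp] subst_def
  have "G \<tturnstile> Exists (Mem 0 (Suc \<tau>))"
    by (rule relE[OF two_point_rel(5)[OF tp]], rule derives.ExI) (simp add: subst_def)
  moreover have "G \<tturnstile> extensional_fm S eq \<tau>" unfolding extensional_fm_def
    by (simp add: simps) (blast intro: rules)
  ultimately show ?thesis unfolding co_quasiorder_fm_def binary_relation_fm_def
    by (simp add: simps subset_prod_two_point[OF tp]) (blast intro: rules)
qed

end


section \<open>Binary sequences\<close>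

text \<open>
  The bounds on the last two quantifiers come from
  \<open>(n, b) = {{n}, {n, b}}\<close>; they make the formula admissible for bounded separation.
\<close>

definition hits_one_fm :: "nat \<Rightarrow> nat \<Rightarrow> fm" where
  "hits_one_fm w a = bex_fm w (And (index_fm (Suc w) 0)
     (bex_fm (Suc a) (bex_fm 0 (bex_fm 0
        (And (one_fm 0) (opair_fm (Suc (Suc 0)) (Suc (Suc (Suc 0))) 0))))))"

lemma rename_hits_one [simp]: "rename f (hits_one_fm w a) = hits_one_fm (f w) (f a)"
  by (simp add: hits_one_fm_def)

text \<open>The bounds are forgotten: of the set between the pair and its second coordinate, only
  the value found in it is retained.\<close>

lemma hits_one_some_one:
  assumes "G \<tturnstile> hits_one_fm w a"
  shows "G \<tturnstile> some_one_fm w a"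
  using assms unfolding hits_one_fm_def
proof (rule bexE, goal_cases)
  case (1 G1 n)
  then have n: "G1 \<tturnstile> index_fm w n" and
    "G1 \<tturnstile> bex_fm a (bex_fm 0 (bex_fm 0 (And (one_fm 0) (opair_fm (Suc (Suc 0)) (Suc (Suc (Suc n))) 0))))"
    by (simp_all add: subst_def and_iff)
  from this(2) show ?case
  proof (rule bexE, goal_cases)
    case (1 G2 p)
    then have "G2 \<tturnstile> bex_fm p (bex_fm 0 (And (one_fm 0) (opair_fm (Suc (Suc p)) (Suc (Suc n)) 0)))"
      by (simp add: subst_def)
    with 1 show ?case
    proof (elim bexE, goal_cases)
      case (1 G3 s)
      then have "G3 \<tturnstile> bex_fm s (And (one_fm 0) (opair_fm (Suc p) (Suc n) 0))"
        by (simp add: subst_def)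
      with 1 show ?case
      proof (elim bexE, goal_cases)
        case (1 G4 b)
        then have b: "G4 \<tturnstile> one_fm b" "G4 \<tturnstile> opair_fm p n b" by (simp_all add: subst_def and_iff)
        have "G4 \<tturnstile> Mem p a" "G4 \<tturnstile> index_fm w n"
          using 1 n by (auto intro: weaken)
        with b show ?case unfolding some_one_fm_def
          by (intro derives.ExI[where t=n])
            (auto simp: subst_def and_iff intro!: derives.ExI[where t=b] intro: relI)
      qed
    qed
  qed
qed

text \<open>The intermediate bound is supplied by the component {n, b} of the pair, which contains
  \<open>b\<close>.\<close>

lemma hits_oneI:
  assumes n: "G \<tturnstile> index_fm w n" and b: "G \<tturnstile> one_fm b"
    and p: "G \<tturnstile> Mem p a" "G \<tturnstile> opair_fm p n b"
  shows "G \<tturnstile> hits_one_fm w a"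
  using p(2)
proof (rule opairE)
  fix G' s t assume G': "set G \<subseteq> set G'" and t: "G' \<tturnstile> Mem t p" "G' \<tturnstile> upair_fm t n b"
  have "G' \<tturnstile> index_fm w n" "G' \<tturnstile> one_fm b" "G' \<tturnstile> Mem p a" "G' \<tturnstile> opair_fm p n b"
    "G' \<tturnstile> Mem b t"
    using assms G' upair_mem(2)[OF t(2)] by (auto intro: weaken)
  note facts = this
  have "G' \<tturnstile> bex_fm t (And (one_fm 0) (opair_fm (Suc p) (Suc n) 0))"
    using facts by (intro bexI[where x=b]) (simp_all add: subst_def and_iff)
  then have "G' \<tturnstile> bex_fm p (bex_fm 0 (And (one_fm 0) (opair_fm (Suc (Suc p)) (Suc (Suc n)) 0)))"
    using t(1) by (intro bexI[where x=t]) (simp_all add: subst_def)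
  then have "G' \<tturnstile> bex_fm a (bex_fm 0 (bex_fm 0
      (And (one_fm 0) (opair_fm (Suc (Suc 0)) (Suc (Suc (Suc n))) 0))))"
    using facts by (intro bexI[where x=p]) (simp_all add: subst_def)
  then show "G' \<tturnstile> hits_one_fm w a" unfolding hits_one_fm_def
    using facts by (intro bexI[where x=n]) (simp_all add: subst_def and_iff index_fm_def)
qed

text \<open>Totality gives a pair \<open>p\<close> in \<open>a\<close> with first coordinate
  \<open>n\<close>, but does not say that its value is 0 or 1. The typing clause presents the same
  \<open>p\<close> as (m, b) with \<open>b\<close> equal to 0 or 1, and injectivity of pairs gives m
  = n.\<close>

lemma binary_sequence_value:
  assumes "G \<tturnstile> binary_sequence_fm w a" "G \<tturnstile> index_fm w n"
    and r: "\<And>G' p b. set G \<subseteq> set G' \<Longrightarrow> G' \<tturnstile> Mem p a \<Longrightarrow> G' \<tturnstile> opair_fm p n b \<Longrightarrow>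
      G' \<tturnstile> Or (empty_fm b) (one_fm b) \<Longrightarrow> G' \<tturnstile> r"
  shows "G \<tturnstile> r"
proof -
  have ball: "G \<tturnstile> ball_fm a (Exists (Exists (And (index_fm (Suc (Suc (Suc w))) (Suc 0))
      (And (Or (empty_fm 0) (one_fm 0)) (opair_fm (Suc (Suc 0)) (Suc 0) 0)))))"
    and total: "G \<tturnstile> Forall (Imp (index_fm (Suc w) 0) (Exists (And (rel_fm (Suc (Suc a)) (Suc 0) 0)
      (Forall (Imp (rel_fm (Suc (Suc (Suc a))) (Suc (Suc 0)) 0) (Eq 0 (Suc 0)))))))"
    using assms(1) by (simp_all add: binary_sequence_fm_def and_iff)
  have "G \<tturnstile> Exists (And (rel_fm (Suc a) (Suc n) 0)
      (Forall (Imp (rel_fm (Suc (Suc a)) (Suc (Suc n)) 0) (Eq 0 (Suc 0)))))"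
    using derives.AllE[OF total, of n] assms(2) by (auto simp: subst_def intro: derives.ImpE)
  then show ?thesis
  proof (rule exE_eigen)
    fix G1 b' assume G1: "set G \<subseteq> set G1" and "G1 \<tturnstile> subst (And (rel_fm (Suc a) (Suc n) 0)
      (Forall (Imp (rel_fm (Suc (Suc a)) (Suc (Suc n)) 0) (Eq 0 (Suc 0))))) b'"
    then have "G1 \<tturnstile> rel_fm a n b'" by (simp add: subst_def and_iff)
    then show "G1 \<tturnstile> r"
    proof (rule relE)
      fix G2 p assume G2: "set G1 \<subseteq> set G2" and p: "G2 \<tturnstile> Mem p a" "G2 \<tturnstile> opair_fm p n b'"
      have "G2 \<tturnstile> Exists (Exists (And (index_fm (Suc (Suc w)) (Suc 0))
          (And (Or (empty_fm 0) (one_fm 0)) (opair_fm (Suc (Suc p)) (Suc 0) 0))))"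
        using ballE[OF weaken[OF weaken[OF ball G1] G2] p(1)] by (simp add: subst_def)
      then show "G2 \<tturnstile> r"
      proof (rule exE_eigen)
        fix G3 m assume G3: "set G2 \<subseteq> set G3"
          and "G3 \<tturnstile> subst (Exists (And (index_fm (Suc (Suc w)) (Suc 0))
            (And (Or (empty_fm 0) (one_fm 0)) (opair_fm (Suc (Suc p)) (Suc 0) 0)))) m"
        then have "G3 \<tturnstile> Exists (And (index_fm (Suc w) (Suc m))
            (And (Or (empty_fm 0) (one_fm 0)) (opair_fm (Suc p) (Suc m) 0)))"
          by (simp add: subst_def)
        then show "G3 \<tturnstile> r"
        proof (rule exE_eigen)
          fix G4 b assume G4: "set G3 \<subseteq> set G4" and "G4 \<tturnstile> subst (And (index_fm (Suc w) (Suc m))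
            (And (Or (empty_fm 0) (one_fm 0)) (opair_fm (Suc p) (Suc m) 0))) b"
          then have b: "G4 \<tturnstile> Or (empty_fm b) (one_fm b)" "G4 \<tturnstile> opair_fm p m b"
            by (simp_all add: subst_def and_iff)
          have "set G2 \<subseteq> set G4" "set G \<subseteq> set G4" using G1 G2 G3 G4 by auto
          note sub = this
          have "G4 \<tturnstile> Eq m n" using b(2) weaken[OF p(2) sub(1)] by (rule opair_inject_fst)
          with derives.EqE[of "{}" G4 m n "opair_fm (Suc p) 0 (Suc b)"] b(2)
          have "G4 \<tturnstile> opair_fm p n b" by (simp add: subst_def)
          then show "G4 \<tturnstile> r" using b(1) weaken[OF p(1) sub(1)] sub(2) by (intro r)
        qed
      qed
    qed
  qed
qed

text \<open>Each value is 0 or 1 by the definition of a binary sequence, and a value 1 contradicts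
  the hypothesis. No case distinction beyond this one is made.\<close>

lemma not_hits_one_all_zero:
  assumes a: "G \<tturnstile> binary_sequence_fm w a" and no: "G \<tturnstile> neg (hits_one_fm w a)"
  shows "G \<tturnstile> all_zero_fm w a"
  unfolding all_zero_fm_def
proof (rule allI_eigen)
  fix n
  have "G \<tturnstile> Imp (index_fm w n) (Exists (And (empty_fm 0) (rel_fm (Suc a) (Suc n) 0)))"
  proof (rule impI_world)
    fix G1 assume G1: "set G \<subseteq> set G1" and n: "G1 \<tturnstile> index_fm w n"
    show "G1 \<tturnstile> Exists (And (empty_fm 0) (rel_fm (Suc a) (Suc n) 0))"
    proof (rule binary_sequence_value[OF weaken[OF a G1] n])
      fix G2 p b assume G2: "set G1 \<subseteq> set G2"
        and p: "G2 \<tturnstile> Mem p a" "G2 \<tturnstile> opair_fm p n b" and b: "G2 \<tturnstile> Or (empty_fm b) (one_fm b)"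
      from b show "G2 \<tturnstile> Exists (And (empty_fm 0) (rel_fm (Suc a) (Suc n) 0))"
      proof (rule orE_world)
        fix G3 assume "set G2 \<subseteq> set G3" "G3 \<tturnstile> empty_fm b"
        with relI[OF p] show "G3 \<tturnstile> Exists (And (empty_fm 0) (rel_fm (Suc a) (Suc n) 0))"
          by (intro derives.ExI[where t=b]) (auto simp: subst_def and_iff intro: weaken)
      next
        fix G3 assume G3: "set G2 \<subseteq> set G3" "G3 \<tturnstile> one_fm b"
        have "set G1 \<subseteq> set G3" "set G \<subseteq> set G3" using G1 G2 G3 by auto
        then have "G3 \<tturnstile> hits_one_fm w a" "G3 \<tturnstile> neg (hits_one_fm w a)"
          using hits_oneI[of G3 w n b p a] n p no G3 by (auto intro: weaken)
        then show "G3 \<tturnstile> Exists (And (empty_fm 0) (rel_fm (Suc a) (Suc n) 0))"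
          by (meson derives.BotE derives.ImpE)
      qed
    qed
  qed
  then show "G \<tturnstile> subst (Imp (index_fm (Suc w) 0)
      (Exists (And (empty_fm 0) (rel_fm (Suc (Suc a)) (Suc 0) 0)))) n"
    by (simp add: subst_def)
qed

lemma hits_one_decided:
  assumes "G \<tturnstile> binary_sequence_fm w a" "G \<tturnstile> Or (hits_one_fm w a) (neg (hits_one_fm w a))"
  shows "G \<tturnstile> Or (all_zero_fm w a) (some_one_fm w a)"
  using assms(2)
  by (rule orE_world)
    (auto intro: derives.OrI1 derives.OrI2 hits_one_some_one not_hits_one_all_zero weaken[OF assms(1)])


section \<open>Instances of the axioms\<close>

text \<open>One direction of the axiom's equivalence gives the two members, the other that there are
  no more.\<close>

lemma pairing_exE:
  assumes "G \<tturnstile> pairing 0"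
    and r: "\<And>G' c. set G \<subseteq> set G' \<Longrightarrow> G' \<tturnstile> upair_fm c x y \<Longrightarrow> G' \<tturnstile> r"
  shows "G \<tturnstile> r"
proof -
  have "G \<tturnstile> Forall (Forall (Exists (Forall
      (And (Imp (Mem 0 (Suc 0)) (Or (Eq 0 (Suc (Suc (Suc 0)))) (Eq 0 (Suc (Suc 0)))))
           (Imp (Or (Eq 0 (Suc (Suc (Suc 0)))) (Eq 0 (Suc (Suc 0)))) (Mem 0 (Suc 0)))))))"
    using assms(1) by (simp add: pairing_def iffF_def connective_defs eval_nat_numeral)
  from derives.AllE[OF derives.AllE[OF this, of x, unfolded subst_def, simplified], of y]
  have "G \<tturnstile> Exists (Forall
      (And (Imp (Mem 0 (Suc 0)) (Or (Eq 0 (Suc (Suc x))) (Eq 0 (Suc (Suc y)))))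
           (Imp (Or (Eq 0 (Suc (Suc x))) (Eq 0 (Suc (Suc y)))) (Mem 0 (Suc 0)))))"
    by (simp add: subst_def)
  then show ?thesis
  proof (rule exE_eigen, goal_cases)
    case (1 G' c)
    then have "G' \<tturnstile> Forall (And (Imp (Mem 0 (Suc c)) (Or (Eq 0 (Suc x)) (Eq 0 (Suc y))))
           (Imp (Or (Eq 0 (Suc x)) (Eq 0 (Suc y))) (Mem 0 (Suc c))))"
      by (simp add: subst_def)
    from derives.AllE[OF this]
    have iff: "G' \<tturnstile> Imp (Mem z c) (Or (Eq z x) (Eq z y))" "G' \<tturnstile> Imp (Or (Eq z x) (Eq z y)) (Mem z c)"
      for z by (simp_all add: subst_def and_iff)
    have "G' \<tturnstile> Mem x c" "G' \<tturnstile> Mem y c"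
      by (rule derives.ImpE[OF iff(2)], rule derives.OrI1 derives.OrI2, rule derives.EqI)+
    moreover have "G' \<tturnstile> ball_fm c (Or (Eq 0 (Suc x)) (Eq 0 (Suc y)))"
    proof (rule ballI_world)
      fix G'' z assume "set G' \<subseteq> set G''" "G'' \<tturnstile> Mem z c"
      with derives.ImpE[OF weaken[OF iff(1)]]
      show "G'' \<tturnstile> subst (Or (Eq 0 (Suc x)) (Eq 0 (Suc y))) z" by (simp add: subst_def)
    qed
    ultimately show ?case using 1(1) by (intro r) (auto simp: upair_fm_def and_iff)
  qed
qed

text \<open>Three uses of pairing: {x}, {x, y}, and the pair of these two.\<close>

lemma opair_exE:
  assumes "G \<tturnstile> pairing 0"
    and r: "\<And>G' p. set G \<subseteq> set G' \<Longrightarrow> G' \<tturnstile> opair_fm p x y \<Longrightarrow> G' \<tturnstile> r"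
  shows "G \<tturnstile> r"
proof (rule pairing_exE[OF assms(1)])
  fix G1 s assume G1: "set G \<subseteq> set G1" and s: "G1 \<tturnstile> upair_fm s x x"
  show "G1 \<tturnstile> r"
  proof (rule pairing_exE[OF weaken[OF assms(1) G1]])
    fix G2 t assume G2: "set G1 \<subseteq> set G2" and t: "G2 \<tturnstile> upair_fm t x y"
    show "G2 \<tturnstile> r"
    proof (rule pairing_exE[OF weaken[OF weaken[OF assms(1) G1] G2]])
      fix G3 p assume G3: "set G2 \<subseteq> set G3" and p: "G3 \<tturnstile> upair_fm p s t"
      have "G3 \<tturnstile> upair_fm s x x" "G3 \<tturnstile> upair_fm t x y" "G3 \<tturnstile> Mem s p" "G3 \<tturnstile> Mem t p"
        using s t G2 G3 upair_mem[OF p] by (auto intro: weaken)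
      then have "G3 \<tturnstile> opair_fm p x y"
        unfolding opair_fm_def and_iff upair_ball[OF p]
        by (intro conjI bexI[where x=s and p="upair_fm 0 (Suc x) (Suc x)"]
              bexI[where x=t and p="upair_fm 0 (Suc x) (Suc y)"])
          (auto simp: subst_def intro: derives.OrI1 derives.OrI2)
      then show "G3 \<tturnstile> r" using G1 G2 G3 by (intro r) auto
    qed
  qed
qed

text \<open>
  The universal closure of the separation axiom for \<open>x = r \<or> (a takes the value 1)\<close> with the
  parameters \<open>a\<close>, \<open>w\<close>, \<open>r\<close>, outermost first.
\<close>

definition tau_separation :: fm where
  "tau_separation = Forall (Forall (Forall (separation (Or (Eq 0 (Suc 0))
     (hits_one_fm (Suc (Suc 0)) (Suc (Suc (Suc 0))))) 0)))"

lemma tau_separation_CZF: "derives CZF [] tau_separation"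
proof -
  \<comment> \<open>Once the notions are unfolded, every quantifier is bounded by a
    variable.\<close>
  have "bounded_fm (Or (Eq 0 (Suc 0)) (hits_one_fm (Suc (Suc 0)) (Suc (Suc (Suc 0)))))"
    unfolding hits_one_fm_def index_fm_def one_fm_def empty_fm_def opair_fm_def upair_fm_def
      bex_fm_def ball_fm_def
    by (intro bounded_fm.intros)
  then have "separation (Or (Eq 0 (Suc 0)) (hits_one_fm (Suc (Suc 0)) (Suc (Suc (Suc 0))))) 0 \<in> CZF"
    by (auto simp: CZF_def)
  then show ?thesis
    unfolding tau_separation_def by (intro derives.AllI) (rule derives.Axiom)
qed

lemma tau_separation_exE:
  assumes "G \<tturnstile> tau_separation"
    and r: "\<And>G' c. set G \<subseteq> set G' \<Longrightarrow>
      \<forall>x. (G' \<tturnstile> Imp (Mem x c) (And (Mem x ap) (Or (Eq x r) (hits_one_fm w a)))) \<and>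
          (G' \<tturnstile> Imp (And (Mem x ap) (Or (Eq x r) (hits_one_fm w a))) (Mem x c)) \<Longrightarrow> G' \<tturnstile> \<psi>"
  shows "G \<tturnstile> \<psi>"
proof -
  \<comment> \<open>Here \<open>c\<close> is the separated set and \<open>b\<close> the set from
    which it is separated.\<close>
  let ?iff = "\<lambda>c b r w a. And (Imp (Mem 0 c) (And (Mem 0 b) (Or (Eq 0 r) (hits_one_fm w a))))
      (Imp (And (Mem 0 b) (Or (Eq 0 r) (hits_one_fm w a))) (Mem 0 c))"
  have "G \<tturnstile> Forall (Forall (Forall (Forall (Exists (Forall (?iff (Suc 0) (Suc (Suc 0))
      (Suc (Suc (Suc 0))) (Suc (Suc (Suc (Suc 0)))) (Suc (Suc (Suc (Suc (Suc 0)))))))))))"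
    using assms(1)
    by (simp add: tau_separation_def separation_def inst_def iffF_def connective_defs eval_nat_numeral)
  \<comment> \<open>The parameters are instantiated outermost first; the fourth instance takes
    \<open>ap\<close> as the set to separate from.\<close>
  from derives.AllE[OF derives.AllE[OF derives.AllE[OF derives.AllE[OF this,
    of a, unfolded subst_def, simplified], of w, unfolded subst_def, simplified],
    of r, unfolded subst_def, simplified], of ap]
  have "G \<tturnstile> Exists (Forall (?iff (Suc 0) (Suc (Suc ap)) (Suc (Suc r)) (Suc (Suc w)) (Suc (Suc a))))"
    by (simp add: subst_def)
  then show ?thesis
  proof (rule exE_eigen, goal_cases)
    case (1 G' c)
    then have "G' \<tturnstile> Forall (?iff (Suc c) (Suc ap) (Suc r) (Suc w) (Suc a))"
      by (simp add: subst_def)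
    from derives.AllE[OF this] 1(1) show ?case
      by (intro r[of G' c]) (simp_all add: subst_def and_iff)
  qed
qed


section \<open>The reduction to LPO\<close>

text \<open>\<open>C S eq ap \<tau> a\<close> stands for the assertion about the class \<open>a\<tau>\<close>.\<close>

definition classes_fm :: "(nat \<Rightarrow> nat \<Rightarrow> nat \<Rightarrow> nat \<Rightarrow> nat \<Rightarrow> fm) \<Rightarrow> fm" where
  "classes_fm C = Forall (Forall (Forall (Imp (set_with_apartness_fm (Suc (Suc 0)) (Suc 0) 0)
     (Forall (Imp (co_quasiorder_fm (Suc (Suc (Suc 0))) (Suc (Suc 0)) (Suc 0) 0)
       (ball_fm (Suc (Suc (Suc 0)))
         (C (Suc (Suc (Suc (Suc 0)))) (Suc (Suc (Suc 0))) (Suc (Suc 0)) (Suc 0) 0)))))))"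

text \<open>As \<open>C\<close> is an arbitrary family of formulas, its behaviour under substitution
  is not computable and is assumed as compatibility with renaming.\<close>

lemma classes_fmD:
  assumes C: "\<And>f S eq ap \<tau> a. rename f (C S eq ap \<tau> a) = C (f S) (f eq) (f ap) (f \<tau>) (f a)"
    and classes: "G \<tturnstile> classes_fm C"
    and G: "G \<tturnstile> set_with_apartness_fm S eq ap" "G \<tturnstile> co_quasiorder_fm S eq ap \<tau>" "G \<tturnstile> Mem a S"
  shows "G \<tturnstile> C S eq ap \<tau> a"
proof -
  from derives.AllE[OF derives.AllE[OF derives.AllE[OF classes[unfolded classes_fm_def],
    of S, unfolded subst_def, simplified C rename.simps rename_ball_bex rename_apartness_set, simplified],
    of eq, unfolded subst_def, simplified C rename.simps rename_ball_bex rename_apartness_set, simplified],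
    of ap]
  have "G \<tturnstile> Imp (set_with_apartness_fm S eq ap) (Forall (Imp (co_quasiorder_fm (Suc S) (Suc eq) (Suc ap) 0)
      (ball_fm (Suc S) (C (Suc (Suc S)) (Suc (Suc eq)) (Suc (Suc ap)) (Suc 0) 0))))"
    by (simp add: subst_def C)
  from derives.AllE[OF derives.ImpE[OF this G(1)], of \<tau>]
  have "G \<tturnstile> Imp (co_quasiorder_fm S eq ap \<tau>) (ball_fm S (C (Suc S) (Suc eq) (Suc ap) (Suc \<tau>) 0))"
    by (simp add: subst_def C)
  from ballE[OF derives.ImpE[OF this G(2)] G(3)] show ?thesis by (simp add: subst_def C)
qed

text \<open>The construction shared by both claims. They differ only in how the assertion about the
  class of \<open>u\<close> yields a decision of \<open>\<phi>\<close>, which is the hypothesis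
  \<open>decide\<close>.\<close>

lemma LPO_if_classes_decide:
  assumes C: "\<And>f S eq ap \<tau> a. rename f (C S eq ap \<tau> a) = C (f S) (f eq) (f ap) (f \<tau>) (f a)"
    and decide: "\<And>G u v S eq ap \<tau> p\<^sub>0 p\<^sub>1 q r \<phi>. two_point u v S eq ap \<tau> p\<^sub>0 p\<^sub>1 q r \<phi> G \<Longrightarrow>
      G \<tturnstile> C S eq ap \<tau> u \<Longrightarrow> G \<tturnstile> Or \<phi> (neg \<phi>)"
  shows "derives CZF [] (Imp (classes_fm C) (LPO 0))"
proof -
  let ?G = "[classes_fm C, tau_separation, pairing 0]"
  have core: "G \<tturnstile> Or (hits_one_fm w a) (neg (hits_one_fm w a))"
    if sub0: "set ?G \<subseteq> set G" and w: "G \<tturnstile> omega_fm w" for G w a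
  proof -
    \<comment> \<open>The point \<open>u\<close> is the empty set contained in omega; below,
      \<open>v\<close> is {u}, that is, 1.\<close>
    have "G \<tturnstile> bex_fm w (empty_fm 0)" using w by (simp add: omega_fm_def inductive_fm_def and_iff)
    then show ?thesis
    proof (rule bexE)
      fix G1 u assume sub1: "set G \<subseteq> set G1" and "G1 \<tturnstile> subst (empty_fm 0) u"
      then have u: "G1 \<tturnstile> empty_fm u" by (simp add: subst_def)
      let ?\<phi> = "hits_one_fm w a"
      have P: "G' \<tturnstile> pairing 0" "G' \<tturnstile> tau_separation" "G' \<tturnstile> classes_fm C"
        if "set G1 \<subseteq> set G'" for G'
        using that sub0 sub1 by (auto intro: derives.Hyp)
      show "G1 \<tturnstile> Or ?\<phi> (neg ?\<phi>)"
      proof (rule pairing_exE[OF P(1)[OF subset_refl]])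
        fix G2 v assume G2: "set G1 \<subseteq> set G2" and v: "G2 \<tturnstile> upair_fm v u u"
        \<comment> \<open>If u = v, then u, being a member of v, would be a member of itself,
          although it is empty.\<close>
        have ne: "G2 \<tturnstile> neg (Eq u v)"
        proof (rule impI_world)
          fix G' assume G': "set G2 \<subseteq> set G'" and uv: "G' \<tturnstile> Eq u v"
          have "G' \<tturnstile> Mem u u"
            using derives.EqE[OF eq_sym[OF uv], of "Mem (Suc u) 0"] upair_mem(1)[OF weaken[OF v G']]
            by (simp add: subst_def)
          moreover have "G' \<tturnstile> ball_fm u Bot"
            using weaken[OF u] G2 G' by (simp add: empty_fm_def)
          ultimately show "G' \<tturnstile> Bot" using ballE[of G' u Bot u] by (simp add: subst_def)
        qed
        \<comment> \<open>The remaining sets come from pairing one after another, and finally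
          \<open>\<tau>\<close> from separation, each in a larger world. All of them are available
          in the last world \<open>H\<close>.\<close>
        show "G2 \<tturnstile> Or ?\<phi> (neg ?\<phi>)"
        proof (rule pairing_exE[OF P(1)])
          fix G3 S assume G3: "set G2 \<subseteq> set G3" and S: "G3 \<tturnstile> upair_fm S u v"
          show "G3 \<tturnstile> Or ?\<phi> (neg ?\<phi>)"
          proof (rule opair_exE[OF P(1)])
            fix G4 p\<^sub>0 assume G4: "set G3 \<subseteq> set G4" and p\<^sub>0: "G4 \<tturnstile> opair_fm p\<^sub>0 u u"
            show "G4 \<tturnstile> Or ?\<phi> (neg ?\<phi>)"
            proof (rule opair_exE[OF P(1)])
              fix G5 p\<^sub>1 assume G5: "set G4 \<subseteq> set G5" and p\<^sub>1: "G5 \<tturnstile> opair_fm p\<^sub>1 v v"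
              show "G5 \<tturnstile> Or ?\<phi> (neg ?\<phi>)"
              proof (rule opair_exE[OF P(1)])
                fix G6 q assume G6: "set G5 \<subseteq> set G6" and q: "G6 \<tturnstile> opair_fm q u v"
                show "G6 \<tturnstile> Or ?\<phi> (neg ?\<phi>)"
                proof (rule opair_exE[OF P(1)])
                  fix G7 r assume G7: "set G6 \<subseteq> set G7" and r: "G7 \<tturnstile> opair_fm r v u"
                  show "G7 \<tturnstile> Or ?\<phi> (neg ?\<phi>)"
                  proof (rule pairing_exE[OF P(1)])
                    fix G8 eq assume G8: "set G7 \<subseteq> set G8" and eq: "G8 \<tturnstile> upair_fm eq p\<^sub>0 p\<^sub>1"
                    show "G8 \<tturnstile> Or ?\<phi> (neg ?\<phi>)"
                    proof (rule pairing_exE[OF P(1)])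
                      fix G9 ap assume G9: "set G8 \<subseteq> set G9" and ap: "G9 \<tturnstile> upair_fm ap q r"
                      show "G9 \<tturnstile> Or ?\<phi> (neg ?\<phi>)"
                      proof (rule tau_separation_exE[OF P(2)])
                        fix H \<tau> assume H: "set G9 \<subseteq> set H" and \<tau>:
                          "\<forall>x. (H \<tturnstile> Imp (Mem x \<tau>) (And (Mem x ap) (Or (Eq x r) ?\<phi>))) \<and>
                               (H \<tturnstile> Imp (And (Mem x ap) (Or (Eq x r) ?\<phi>)) (Mem x \<tau>))"
                        note subs = G2 G3 G4 G5 G6 G7 G8 G9 H
                        have "H \<tturnstile> neg (Eq u v)" by (rule weaken[OF ne]) (use subs in blast)
                        moreover have "H \<tturnstile> upair_fm S u v" by (rule weaken[OF S]) (use subs in blast)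
                        moreover have "H \<tturnstile> opair_fm p\<^sub>0 u u" by (rule weaken[OF p\<^sub>0]) (use subs in blast)
                        moreover have "H \<tturnstile> opair_fm p\<^sub>1 v v" by (rule weaken[OF p\<^sub>1]) (use subs in blast)
                        moreover have "H \<tturnstile> opair_fm q u v" by (rule weaken[OF q]) (use subs in blast)
                        moreover have "H \<tturnstile> opair_fm r v u" by (rule weaken[OF r]) (use subs in blast)
                        moreover have "H \<tturnstile> upair_fm eq p\<^sub>0 p\<^sub>1" by (rule weaken[OF eq]) (use subs in blast)
                        moreover have "H \<tturnstile> upair_fm ap q r" by (rule weaken[OF ap]) (use subs in blast)
                        ultimately have tp: "two_point u v S eq ap \<tau> p\<^sub>0 p\<^sub>1 q r ?\<phi> H"
                          using \<tau> by (simp add: two_point_def)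
                        have "H \<tturnstile> classes_fm C" by (rule P(3)) (use subs in blast)
                        then have "H \<tturnstile> C S eq ap \<tau> u"
                          by (rule classes_fmD[where C=C, OF C])
                            (use two_point_set_with_apartness[OF tp] two_point_co_quasiorder[OF tp]
                              upair_mem(1)[OF \<open>H \<tturnstile> upair_fm S u v\<close>] in auto)
                        with tp show "H \<tturnstile> Or ?\<phi> (neg ?\<phi>)" by (rule decide)
                      qed (use G2 G3 G4 G5 G6 G7 G8 G9 in blast)
                    qed (use G2 G3 G4 G5 G6 G7 G8 in blast)
                  qed (use G2 G3 G4 G5 G6 G7 in blast)
                qed (use G2 G3 G4 G5 G6 in blast)
              qed (use G2 G3 G4 G5 in blast)
            qed (use G2 G3 G4 in blast)
          qed (use G2 G3 in blast)
        qed (use G2 in blast)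
      qed
    qed
  qed
  have "?G \<tturnstile> LPO 0"
    unfolding LPO_eq
  proof (rule allI_eigen, simp add: subst_def, rule allI_eigen, simp add: subst_def, rule impI_world)
    fix w a G assume "set ?G \<subseteq> set G" "G \<tturnstile> And (omega_fm w) (binary_sequence_fm w a)"
    then show "G \<tturnstile> Or (all_zero_fm w a) (some_one_fm w a)"
      using core[of G w a] by (simp add: and_iff hits_one_decided)
  qed
  \<comment> \<open>Back to CZF: the three hypotheses are discharged, and pairing and the instance
    of separation are removed as theorems of CZF. The assertion about classes remains as the
    antecedent.\<close>
  then have "derives CZF ?G (LPO 0)" by (rule derives_weaken) auto
  then have "derives CZF [] (Imp (pairing 0) (Imp tau_separation (Imp (classes_fm C) (LPO 0))))"
    by (intro derives.ImpI)
  moreover have "derives CZF [] (pairing 0)" by (rule derives.Axiom) (simp add: CZF_def)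
  ultimately show ?thesis using tau_separation_CZF by (meson derives.ImpE)
qed

section \<open>The d-subset and sd-subset conditions\<close>

definition d_class_fm :: "nat \<Rightarrow> nat \<Rightarrow> nat \<Rightarrow> nat \<Rightarrow> nat \<Rightarrow> fm" where
  "d_class_fm S eq ap \<tau> a = ball_fm S (Or (And (Mem 0 (Suc S)) (rel_fm (Suc \<tau>) (Suc a) 0))
     (And (Mem 0 (Suc S)) (neg (And (Mem 0 (Suc S)) (rel_fm (Suc \<tau>) (Suc a) 0)))))"

text \<open>In both conditions membership in \<open>S\<close> recurs because each class carries it
  as its first conjunct.\<close>

definition sd_class_fm :: "nat \<Rightarrow> nat \<Rightarrow> nat \<Rightarrow> nat \<Rightarrow> nat \<Rightarrow> fm" where
  "sd_class_fm S eq ap \<tau> a = ball_fm S (Or (And (Mem 0 (Suc S)) (rel_fm (Suc \<tau>) (Suc a) 0))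
     (And (Mem 0 (Suc S)) (Forall (Imp
       (And (Mem 0 (Suc (Suc S))) (rel_fm (Suc (Suc \<tau>)) (Suc (Suc a)) 0))
       (rel_fm (Suc (Suc ap)) (Suc 0) 0)))))"

text \<open>The condition is taken at the point \<open>v\<close>. Since (u, v) lies in
  \<open>\<tau>\<close> exactly if \<open>\<phi>\<close> holds, and this in every larger world, the
  negative alternative refutes \<open>\<phi>\<close> too.\<close>

lemma two_point_d_decides:
  assumes tp: "two_point u v S eq ap \<tau> p\<^sub>0 p\<^sub>1 q r \<phi> G" and d: "G \<tturnstile> d_class_fm S eq ap \<tau> u"
  shows "G \<tturnstile> Or \<phi> (neg \<phi>)"
proof -
  have "G \<tturnstile> Or (And (Mem v S) (rel_fm \<tau> u v))
      (And (Mem v S) (neg (And (Mem v S) (rel_fm \<tau> u v))))"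
    using d unfolding d_class_fm_def two_point_ball[OF tp] by (simp add: subst_def)
  then show ?thesis
  proof (rule orE_world)
    fix G' assume "set G \<subseteq> set G'" "G' \<tturnstile> And (Mem v S) (rel_fm \<tau> u v)"
    with two_point_tau_decides[OF two_point_weaken[OF tp]]
    show "G' \<tturnstile> Or \<phi> (neg \<phi>)" by (auto simp: and_iff intro: derives.OrI1)
  next
    fix G' assume G': "set G \<subseteq> set G'"
      and no: "G' \<tturnstile> And (Mem v S) (neg (And (Mem v S) (rel_fm \<tau> u v)))"
    have "G' \<tturnstile> neg \<phi>"
    proof (rule impI_world)
      fix G'' assume G'': "set G' \<subseteq> set G''" "G'' \<tturnstile> \<phi>"
      then have "G'' \<tturnstile> rel_fm \<tau> u v"
        using two_point_tau_decides[OF two_point_weaken[OF tp]] G' by blast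
      with weaken[OF no G''(1)] show "G'' \<tturnstile> Bot"
        by (auto simp: and_iff intro: derives.ImpE)
    qed
    then show "G' \<tturnstile> Or \<phi> (neg \<phi>)" by (rule derives.OrI2)
  qed
qed

lemma two_point_sd_decides:
  assumes tp: "two_point u v S eq ap \<tau> p\<^sub>0 p\<^sub>1 q r \<phi> G" and sd: "G \<tturnstile> sd_class_fm S eq ap \<tau> u"
  shows "G \<tturnstile> Or \<phi> (neg \<phi>)"
proof -
  have "G \<tturnstile> Or (And (Mem v S) (rel_fm \<tau> u v))
      (And (Mem v S) (Forall (Imp (And (Mem 0 (Suc S)) (rel_fm (Suc \<tau>) (Suc u) 0))
        (rel_fm (Suc ap) (Suc v) 0))))"
    using sd unfolding sd_class_fm_def two_point_ball[OF tp] by (simp add: subst_def)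
  then show ?thesis
  proof (rule orE_world)
    fix G' assume "set G \<subseteq> set G'" "G' \<tturnstile> And (Mem v S) (rel_fm \<tau> u v)"
    with two_point_tau_decides[OF two_point_weaken[OF tp]]
    show "G' \<tturnstile> Or \<phi> (neg \<phi>)" by (auto simp: and_iff intro: derives.OrI1)
  next
    fix G' assume G': "set G \<subseteq> set G'"
      and "G' \<tturnstile> And (Mem v S) (Forall (Imp (And (Mem 0 (Suc S)) (rel_fm (Suc \<tau>) (Suc u) 0))
        (rel_fm (Suc ap) (Suc v) 0)))"
    then have v: "G' \<tturnstile> Mem v S" and "G' \<tturnstile> Forall (Imp
        (And (Mem 0 (Suc S)) (rel_fm (Suc \<tau>) (Suc u) 0)) (rel_fm (Suc ap) (Suc v) 0))"
      by (simp_all add: and_iff)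
    \<comment> \<open>The point \<open>v\<close> is compared with itself: under
      \<open>\<phi>\<close> it belongs to the class, so it would be apart from itself.\<close>
    from derives.AllE[OF this(2), of v]
    have no: "G' \<tturnstile> Imp (And (Mem v S) (rel_fm \<tau> u v)) (rel_fm ap v v)" by (simp add: subst_def)
    have "G' \<tturnstile> neg \<phi>"
    proof (rule impI_world)
      fix G'' assume G'': "set G' \<subseteq> set G''" "G'' \<tturnstile> \<phi>"
      have tp'': "two_point u v S eq ap \<tau> p\<^sub>0 p\<^sub>1 q r \<phi> G''"
        using two_point_weaken[OF tp] G' G'' by blast
      then have "G'' \<tturnstile> rel_fm \<tau> u v" using two_point_tau_decides G''(2) by blast
      with weaken[OF no G''(1)] weaken[OF v G''(1)] have "G'' \<tturnstile> rel_fm ap v v"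
        by (meson and_iff derives.ImpE)
      with two_point_not_rel(4)[OF tp''] show "G'' \<tturnstile> Bot" by (rule derives.ImpE)
    qed
    then show "G' \<tturnstile> Or \<phi> (neg \<phi>)" by (rule derives.OrI2)
  qed
qed

theorem proposition3p14:
  shows "(CZF \<turnstile>
     (\<^bold>\<forall>S eq ap. set_with_apartness S eq ap \<^bold>\<longrightarrow>
        (\<^bold>\<forall>\<tau>. co_quasiorder S eq ap \<tau> \<^bold>\<longrightarrow>
           (\<^bold>\<forall>a\<^bold>\<in>S. d_subset S (right_class S \<tau> a))))
     \<^bold>\<longrightarrow> LPO)
   \<and> (CZF \<turnstile>
     (\<^bold>\<forall>S eq ap. set_with_apartness S eq ap \<^bold>\<longrightarrow>
        (\<^bold>\<forall>\<tau>. co_quasiorder S eq ap \<tau> \<^bold>\<longrightarrow>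
           (\<^bold>\<forall>a\<^bold>\<in>S. sd_subset S ap (right_class S \<tau> a))))
     \<^bold>\<longrightarrow> LPO)"
proof
  have "derives CZF [] (Imp (classes_fm d_class_fm) (LPO 0))"
    by (rule LPO_if_classes_decide) (simp add: d_class_fm_def, rule two_point_d_decides)
  then show "CZF \<turnstile>
     (\<^bold>\<forall>S eq ap. set_with_apartness S eq ap \<^bold>\<longrightarrow>
        (\<^bold>\<forall>\<tau>. co_quasiorder S eq ap \<tau> \<^bold>\<longrightarrow>
           (\<^bold>\<forall>a\<^bold>\<in>S. d_subset S (right_class S \<tau> a))))
     \<^bold>\<longrightarrow> LPO"
    \<comment> \<open>At depth 0 the variables \<open>S\<close>, \<open>eq\<close>,
      \<open>ap\<close>, \<open>\<tau>\<close>, \<open>a\<close> receive levels 0 to 4, and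
      converting levels to indices gives \<open>classes_fm\<close> for this condition.\<close>
    by (simp add: proves_def classes_fm_def d_class_fm_def connective_defs ballF_eq bexF_eq
        d_subset_def right_class_def logical_complement_def eval_nat_numeral)
next
  have "derives CZF [] (Imp (classes_fm sd_class_fm) (LPO 0))"
    by (rule LPO_if_classes_decide) (simp add: sd_class_fm_def, rule two_point_sd_decides)
  then show "CZF \<turnstile>
     (\<^bold>\<forall>S eq ap. set_with_apartness S eq ap \<^bold>\<longrightarrow>
        (\<^bold>\<forall>\<tau>. co_quasiorder S eq ap \<tau> \<^bold>\<longrightarrow>
           (\<^bold>\<forall>a\<^bold>\<in>S. sd_subset S ap (right_class S \<tau> a))))
     \<^bold>\<longrightarrow> LPO"
    by (simp add: proves_def classes_fm_def sd_class_fm_def connective_defs ballF_eq bexF_eq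
        sd_subset_def right_class_def apartness_complement_def eval_nat_numeral)
qed

end
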